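(* Let $f$ be $(\delta_f,L_f)$-approximately smooth with components $(\bar f,\bar g)$, let $\|x-y\|\le D$ for all $x,y\in\operatorname{dom}\psi$ (where $D>0$), and let $\hat g$ be an unbiased stochastic oracle for $\bar g$ for which there exist $\delta_{\hat g},L_{\hat g}\ge0$ such that $\mathrm{Var}_{\hat g}(x,y)\le2L_{\hat g}[\beta(x,y)+\delta_{\hat g}]$ for all $x,y\in\mathbb R^d$. Let $\sigma_*^2:=\mathrm{Var}_{\hat g}(x^* )$. Let UniversalSgd (defined in the context), with a stepsize update rule $M_+(\cdot)$ satisfying the requirement (R) of the context with constants $c_1,c_2,c_3,c_4>0$, be run for $N\ge1$ iterations from a point $x_0\in\operatorname{dom}\psi$ with $M_0=0$ and diameter parameter $D$. Then, for the point $\bar x_N$ produced by the method, $$\mathbb E[F(\bar x_N)]-F^*\le\frac{c_4(c_2L_f+12c_1L_{\hat g})D^2}{N}+2\sigma_*D\sqrt{\frac{6c_1c_4}{N}}+c_3\delta_f+\frac43\delta_{\hat g}.$$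
   Context: Space: $\mathbb R^d$ with standard inner product $\langle\cdot,\cdot\rangle$, norm $\|x\|=\langle Bx,x\rangle^{1/2}$ ($B$ a fixed positive definite matrix), dual norm $\|s\|_*=\max_{\|x\|=1}\langle s,x\rangle=\langle s,B^{-1}s\rangle^{1/2}$. $[t]_+=\max\{t,0\}$. Problem: $F^*=\min_{x\in\operatorname{dom}\psi}[F(x):=f(x)+\psi(x)]$, where $f:\mathbb R^d\to\mathbb R$ is convex, $\psi:\mathbb R^d\to\mathbb R\cup\{+\infty\}$ is proper closed convex, $\operatorname{dom}\psi=\{x:\psi(x)<+\infty\}$; a solution $x^*$ is assumed to exist. Approximate smoothness: $f$ is $(\delta_f,L_f)$-approximately smooth ($\delta_f,L_f\ge0$) with components $\bar f:\mathbb R^d\to\mathbb R$, $\bar g:\mathbb R^d\to\mathbb R^d$ if $\beta(x,y):=f(y)-\bar f(x)-\langle\bar g(x),y-x\rangle$ satisfies $0\le\beta(x,y)\le\frac{L_f}{2}\|x-y\|^2+\delta_f$ for all $x,y\in\mathbb R^d$. Stochastic oracle: $\hat g=(g,\xi)$ is a random variable $\xi$ with a mapping $g$; a query at $x$ generates an independent copy of $\xi$ and returns $g(x,\xi)$. It is unbiased for $\bar g$ if $\mathbb E_\xi[g(x,\xi)]=\bar g(x)$ for all $x$. $\mathrm{Var}_{\hat g}(x)=\mathbb E_\xi[\|g(x,\xi)-\bar g(x)\|_*^2]$ and $\mathrm{Var}_{\hat g}(x,y)=\mathbb E_\xi[\|[g(x,\xi)-g(y,\xi)]-[\bar g(x)-\bar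 g(y)]\|_*^2]$. Proximal map: $\mathrm{Prox}_\psi(x,g,M)=\operatorname{argmin}_{y\in\operatorname{dom}\psi}\{\langle g,y\rangle+\psi(y)+\frac M2\|y-x\|^2\}$, $M\ge 0$ (if $M=0$, any minimizer may be chosen). Requirement (R) on the stepsize update rule $M_+(\cdot)$, with (absolute) constants $c_1,\dots,c_4>0$: given the current stepsize coefficient $M\ge0$, a constant $\Omega>0$, the current point $x\in\operatorname{dom}\psi$ with the stochastic gradient $\hat g_x$ (the output of a query of $\hat g$ at $x$), and the next random point $\hat x_+\in\operatorname{dom}\psi$ (possibly dependent on $\hat g_x$) with the stochastic gradient $\hat g_{x_+}$ (the output of a query of $\hat g$ at $\hat x_+$), the rule computes $\hat M_+=M_+(M,\Omega,x,\hat x_+,\hat g_x,\hat g_{x_+})$ such that $\hat M_+\ge M$ and, for any $\bar M>c_2L_f$, $$\mathbb E[\hat\Delta(\hat M_+)+(\hat M_+-M)\Omega+\beta(\hat x_+,x)]\le\frac{c_1}{\bar M-c_2L_f}\mathbb E[\mathrm{Var}_{\hat g}(\hat x_+)+\mathrm{Var}_{\hat g}(x)]+c_3\delta_f+c_4\mathbb E\{[\min\{\hat M_+,\bar M\}-M]_+\Omega\},$$ where $\hat\Delta(\hat M_+)=\beta(x,\hat x_+)+\langle\bar g(x)-\hat g_x,\hat x_+-x\rangle-\frac{\hat M_+}{2}\|\hat x_+-x\|^2$ and the expectation is taken with respect to the entire randomness. (Main example: $\hat M_+=\sqrt{M^2+\frac1\Omega\|\hat g_{x_+}-\hat g_x\|_*^2}$,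 with $c_1=\frac52,c_2=4,c_3=6,c_4=2$.) UniversalSgd with oracle $\hat g$, inputs $x_0\in\operatorname{dom}\psi$, $M_0$, $N$, $D$: query $g_0$ from $\hat g$ at $x_0$; for $k=0,\dots,N-1$: $x_{k+1}=\mathrm{Prox}_\psi(x_k,g_k,M_k)$; query $g_{k+1}$ from $\hat g$ at $x_{k+1}$; $M_{k+1}=M_+(M_k,D^2,x_k,x_{k+1},g_k,g_{k+1})$. Output $(\bar x_N,x_N,M_N)$ with $\bar x_N=\frac1N\sum_{i=1}^Nx_i$. *)

theory Defs
  imports "HOL-Probability.Probability"
begin

definition positive_definite :: "real^'n^'n \<Rightarrow> bool" where
  "positive_definite B \<longleftrightarrow> transpose B = B \<and> (\<forall>x. x \<noteq> 0 \<longrightarrow> 0 < (B *v x) \<bullet> x)"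

definition bnorm :: "real^'n^'n \<Rightarrow> real^'n \<Rightarrow> real" where
  "bnorm B x = sqrt ((B *v x) \<bullet> x)"

text \<open>For positive definite \<open>B\<close> the unit sphere is compact and nonempty, so the supremum is a maximum.\<close>

definition dual_norm :: "real^'n^'n \<Rightarrow> real^'n \<Rightarrow> real" where
  "dual_norm B s = (SUP x\<in>{x. bnorm B x = 1}. s \<bullet> x)"

definition edom :: "('a \<Rightarrow> ereal) \<Rightarrow> 'a set" where
  "edom \<psi> = {x. \<psi> x < \<infinity>}"

definition eepigraph :: "('a \<Rightarrow> ereal) \<Rightarrow> ('a \<times> real) set" where
  "eepigraph \<psi> = {(x, t). \<psi> x \<le> ereal t}"

definition proper_closed_convex :: "(real^'n \<Rightarrow> ereal) \<Rightarrow> bool" where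
  "proper_closed_convex \<psi> \<longleftrightarrow>
     (\<forall>x. \<psi> x \<noteq> -\<infinity>) \<and> edom \<psi> \<noteq> {} \<and> closed (eepigraph \<psi>) \<and> convex (eepigraph \<psi>)"

definition objective :: "(real^'n \<Rightarrow> real) \<Rightarrow> (real^'n \<Rightarrow> ereal) \<Rightarrow> real^'n \<Rightarrow> ereal" where
  "objective f \<psi> x = ereal (f x) + \<psi> x"

definition optimal_value :: "(real^'n \<Rightarrow> real) \<Rightarrow> (real^'n \<Rightarrow> ereal) \<Rightarrow> ereal" where
  "optimal_value f \<psi> = (INF x\<in>edom \<psi>. objective f \<psi> x)"

definition Prox ::
  "real^'n^'n \<Rightarrow> (real^'n \<Rightarrow> ereal) \<Rightarrow> real^'n \<Rightarrow> real^'n \<Rightarrow> real \<Rightarrow> (real^'n) set" where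
  "Prox B \<psi> x g M =
     {y. is_arg_min (\<lambda>y. ereal (g \<bullet> y) + \<psi> y + ereal (M / 2 * (bnorm B (y - x))\<^sup>2))
           (\<lambda>y. y \<in> edom \<psi>) y}"

definition lin_err ::
  "(real^'n \<Rightarrow> real) \<Rightarrow> (real^'n \<Rightarrow> real) \<Rightarrow> (real^'n \<Rightarrow> real^'n) \<Rightarrow> real^'n \<Rightarrow> real^'n \<Rightarrow> real" where
  "lin_err f fbar gbar x y = f y - fbar x - gbar x \<bullet> (y - x)"

definition approx_smooth ::
  "real^'n^'n \<Rightarrow> real \<Rightarrow> real \<Rightarrow> (real^'n \<Rightarrow> real) \<Rightarrow> (real^'n \<Rightarrow> real)
    \<Rightarrow> (real^'n \<Rightarrow> real^'n) \<Rightarrow> bool" where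
  "approx_smooth B \<delta> L f fbar gbar \<longleftrightarrow> 0 \<le> \<delta> \<and> 0 \<le> L \<and>
     (\<forall>x y. 0 \<le> lin_err f fbar gbar x y \<and>
            lin_err f fbar gbar x y \<le> L / 2 * (bnorm B (x - y))\<^sup>2 + \<delta>)"

text \<open>An oracle consists of the law \<open>\<Xi>\<close> of its random seed and a jointly measurable map \<open>g\<close>.\<close>

definition stochastic_oracle :: "'s measure \<Rightarrow> (real^'n \<Rightarrow> 's \<Rightarrow> real^'n) \<Rightarrow> bool" where
  "stochastic_oracle \<Xi> g \<longleftrightarrow>
     prob_space \<Xi> \<and> (\<lambda>(x, s). g x s) \<in> borel_measurable (borel \<Otimes>\<^sub>M \<Xi>)"

definition unbiased ::
  "'s measure \<Rightarrow> (real^'n \<Rightarrow> 's \<Rightarrow> real^'n) \<Rightarrow> (real^'n \<Rightarrow> real^'n) \<Rightarrow> bool" where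
  "unbiased \<Xi> g gbar \<longleftrightarrow> (\<forall>x. has_bochner_integral \<Xi> (g x) (gbar x))"

text \<open>Variances take values in \<open>[0, \<infinity>]\<close>, so that bounding them entails square integrability.\<close>

definition oracle_var ::
  "real^'n^'n \<Rightarrow> 's measure \<Rightarrow> (real^'n \<Rightarrow> 's \<Rightarrow> real^'n) \<Rightarrow> (real^'n \<Rightarrow> real^'n)
    \<Rightarrow> real^'n \<Rightarrow> ennreal" where
  "oracle_var B \<Xi> g gbar x = (\<integral>\<^sup>+ s. ennreal ((dual_norm B (g x s - gbar x))\<^sup>2) \<partial>\<Xi>)"

definition oracle_var2 ::
  "real^'n^'n \<Rightarrow> 's measure \<Rightarrow> (real^'n \<Rightarrow> 's \<Rightarrow> real^'n) \<Rightarrow> (real^'n \<Rightarrow> real^'n)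
    \<Rightarrow> real^'n \<Rightarrow> real^'n \<Rightarrow> ennreal" where
  "oracle_var2 B \<Xi> g gbar x y =
     (\<integral>\<^sup>+ s. ennreal ((dual_norm B ((g x s - g y s) - (gbar x - gbar y)))\<^sup>2) \<partial>\<Xi>)"

text \<open>\<open>s\<close> has law \<open>\<Xi>\<close> and is independent of the \<open>H\<close>-valued random element \<open>h\<close>.
  Independence is that of the generated \<open>\<sigma>\<close>-algebras; the library constant \<open>indep_var\<close>
  does not apply because \<open>h\<close> and \<open>s\<close> take values in different types.\<close>

definition independent_copy ::
  "'w measure \<Rightarrow> 's measure \<Rightarrow> ('w \<Rightarrow> 's) \<Rightarrow> 'h measure \<Rightarrow> ('w \<Rightarrow> 'h) \<Rightarrow> bool" where
  "independent_copy P \<Xi> s H h \<longleftrightarrow>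
     s \<in> P \<rightarrow>\<^sub>M \<Xi> \<and> distr P \<Xi> s = \<Xi> \<and> h \<in> P \<rightarrow>\<^sub>M H \<and>
     prob_space.indep_set P
       (sets (vimage_algebra (space P) h H)) (sets (vimage_algebra (space P) s \<Xi>))"

text \<open>\<open>E[Z] \<le> C\<close> for a real random variable \<open>Z\<close> that need not be integrable, in the form
  \<open>E[Z\<^sup>+] \<le> C + E[Z\<^sup>-]\<close>. If \<open>E[Z\<^sup>-]\<close> is finite, this says that the
  extended expectation \<open>E[Z] \<in> (-\<infinity>, \<infinity>]\<close> is at most \<open>C\<close>.\<close>

definition expectation_le :: "'w measure \<Rightarrow> ('w \<Rightarrow> real) \<Rightarrow> ennreal \<Rightarrow> bool" where
  "expectation_le P Z C \<longleftrightarrow>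
     (\<integral>\<^sup>+ \<omega>. ennreal (Z \<omega>) \<partial>P) \<le> C + (\<integral>\<^sup>+ \<omega>. ennreal (- Z \<omega>) \<partial>P)"

text \<open>The requirement on a rule \<open>upd M \<Omega> x x\<^sub>+ g\<^sub>x g\<^sub>x\<^sub>+\<close>. The random elements
  \<open>M, x, x\<^sub>+, s, s\<^sub>+\<close> live on \<open>P\<close>, where \<open>s\<close> and \<open>s\<^sub>+\<close> are the seeds of the two
  queries. The coefficient \<open>M\<close> may depend on \<open>s\<close>: in the method below, \<open>M\<^sub>k\<close> is
  computed from the gradient \<open>g\<^sub>k\<close> with which it is then used.\<close>

definition stepsize_requirement ::
  "'w measure \<Rightarrow> real^'n^'n \<Rightarrow> (real^'n \<Rightarrow> real) \<Rightarrow> (real^'n \<Rightarrow> real) \<Rightarrow> (real^'n \<Rightarrow> real^'n)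
    \<Rightarrow> (real^'n \<Rightarrow> ereal) \<Rightarrow> 's measure \<Rightarrow> (real^'n \<Rightarrow> 's \<Rightarrow> real^'n) \<Rightarrow> real \<Rightarrow> real
    \<Rightarrow> (real \<Rightarrow> real \<Rightarrow> real^'n \<Rightarrow> real^'n \<Rightarrow> real^'n \<Rightarrow> real^'n \<Rightarrow> real)
    \<Rightarrow> real \<Rightarrow> real \<Rightarrow> real \<Rightarrow> real \<Rightarrow> bool" where
  "stepsize_requirement P B f fbar gbar \<psi> \<Xi> g \<delta> L upd c1 c2 c3 c4 \<longleftrightarrow>
    (\<forall>M \<ge> 0. \<forall>\<Omega> > 0. \<forall>x \<in> edom \<psi>. \<forall>xp \<in> edom \<psi>. \<forall>s \<in> space \<Xi>. \<forall>sp \<in> space \<Xi>.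
       M \<le> upd M \<Omega> x xp (g x s) (g xp sp)) \<and>
    (\<forall>\<Omega> > 0. \<forall>M x xp s sp. \<forall>Mbar > c2 * L.
       M \<in> borel_measurable P \<longrightarrow> x \<in> borel_measurable P \<longrightarrow> xp \<in> borel_measurable P \<longrightarrow>
       (\<forall>\<omega> \<in> space P. 0 \<le> M \<omega> \<and> x \<omega> \<in> edom \<psi> \<and> xp \<omega> \<in> edom \<psi>) \<longrightarrow>
       independent_copy P \<Xi> s borel x \<longrightarrow>
       independent_copy P \<Xi> sp (borel \<Otimes>\<^sub>M borel \<Otimes>\<^sub>M \<Xi> \<Otimes>\<^sub>M borel) (\<lambda>\<omega>. (M \<omega>, x \<omega>, s \<omega>, xp \<omega>)) \<longrightarrow>
       (let gx = (\<lambda>\<omega>. g (x \<omega>) (s \<omega>));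
            gxp = (\<lambda>\<omega>. g (xp \<omega>) (sp \<omega>));
            Mp = (\<lambda>\<omega>. upd (M \<omega>) \<Omega> (x \<omega>) (xp \<omega>) (gx \<omega>) (gxp \<omega>));
            \<Delta> = (\<lambda>\<omega>. lin_err f fbar gbar (x \<omega>) (xp \<omega>)
                     + (gbar (x \<omega>) - gx \<omega>) \<bullet> (xp \<omega> - x \<omega>)
                     - Mp \<omega> / 2 * (bnorm B (xp \<omega> - x \<omega>))\<^sup>2)
        in expectation_le P
             (\<lambda>\<omega>. \<Delta> \<omega> + (Mp \<omega> - M \<omega>) * \<Omega> + lin_err f fbar gbar (xp \<omega>) (x \<omega>))
             (ennreal (c1 / (Mbar - c2 * L))
                * (\<integral>\<^sup>+ \<omega>. oracle_var B \<Xi> g gbar (xp \<omega>) + oracle_var B \<Xi> g gbar (x \<omega>) \<partial>P)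
              + ennreal (c3 * \<delta>)
              + ennreal c4 * (\<integral>\<^sup>+ \<omega>. ennreal (max 0 (min (Mp \<omega>) Mbar - M \<omega>) * \<Omega>) \<partial>P))))"

text \<open>\<open>s k\<close> is the seed of the query at \<open>x k\<close>, so that \<open>g\<^sub>k = g (x k) (s k)\<close>. It is a fresh copy,
  independent of everything that precedes it. Since \<open>x (k + 1)\<close> is only required to belong to
  the set of minimizers, the choice of minimizer in the case \<open>M k = 0\<close> is arbitrary,
  subject to measurability and to not anticipating later seeds. Each \<open>M k\<close> is a function
  of \<open>x 0, \<dots>, x k, s 0, \<dots>, s k\<close> and hence needs no mention in the independence condition.\<close>

definition universal_sgd ::
  "'w measure \<Rightarrow> real^'n^'n \<Rightarrow> (real^'n \<Rightarrow> ereal) \<Rightarrow> 's measure \<Rightarrow> (real^'n \<Rightarrow> 's \<Rightarrow> real^'n)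
    \<Rightarrow> (real \<Rightarrow> real \<Rightarrow> real^'n \<Rightarrow> real^'n \<Rightarrow> real^'n \<Rightarrow> real^'n \<Rightarrow> real)
    \<Rightarrow> real^'n \<Rightarrow> real \<Rightarrow> nat \<Rightarrow> real
    \<Rightarrow> (nat \<Rightarrow> 'w \<Rightarrow> 's) \<Rightarrow> (nat \<Rightarrow> 'w \<Rightarrow> real^'n) \<Rightarrow> (nat \<Rightarrow> 'w \<Rightarrow> real) \<Rightarrow> bool" where
  "universal_sgd P B \<psi> \<Xi> g upd x0 M0 N D s x M \<longleftrightarrow>
    (\<forall>\<omega> \<in> space P. x 0 \<omega> = x0 \<and> M 0 \<omega> = M0) \<and>
    (\<forall>k \<le> N. independent_copy P \<Xi> (s k)
       ((\<Pi>\<^sub>M i\<in>{..k}. borel) \<Otimes>\<^sub>M (\<Pi>\<^sub>M i\<in>{..<k}. \<Xi>))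
       (\<lambda>\<omega>. (\<lambda>i\<in>{..k}. x i \<omega>, \<lambda>i\<in>{..<k}. s i \<omega>))) \<and>
    (\<forall>k < N. \<forall>\<omega> \<in> space P.
       x (Suc k) \<omega> \<in> Prox B \<psi> (x k \<omega>) (g (x k \<omega>) (s k \<omega>)) (M k \<omega>) \<and>
       M (Suc k) \<omega> = upd (M k \<omega>) (D\<^sup>2) (x k \<omega>) (x (Suc k) \<omega>)
         (g (x k \<omega>) (s k \<omega>)) (g (x (Suc k) \<omega>) (s (Suc k) \<omega>)))"

definition average_iterate :: "nat \<Rightarrow> (nat \<Rightarrow> 'w \<Rightarrow> real^'n) \<Rightarrow> 'w \<Rightarrow> real^'n" where
  "average_iterate N x \<omega> = (1 / real N) *\<^sub>R (\<Sum>i=1..N. x i \<omega>)"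

end

theory Submission
  imports Defs
begin

text \<open>
  Comparing the proximal step with \<open>x\<^sup>*\<close> gives, with \<open>\<Phi>\<^sub>k = M\<^sub>k/2 \<parallel>x\<^sub>k - x\<^sup>*\<parallel>\<^sup>2\<close> and
  \<open>Z\<^sub>k\<close> the random variable whose expectation the requirement on the stepsize rule bounds,
  \<open>F(x\<^sub>k\<^sub>+\<^sub>1) - F\<^sup>* + \<beta>(x\<^sub>k, x\<^sup>*) + \<beta>(x\<^sub>k\<^sub>+\<^sub>1, x\<^sub>k) + \<Phi>\<^sub>k\<^sub>+\<^sub>1 \<le> Z\<^sub>k + \<Phi>\<^sub>k + noise\<close>
  with a centred noise. Since
  \<open>Var(x\<^sub>k\<^sub>+\<^sub>1) + Var(x\<^sub>k) \<le> 12 L\<^sub>g (\<beta>(x\<^sub>k, x\<^sup>*) + \<beta>(x\<^sub>k\<^sub>+\<^sub>1, x\<^sub>k)) + 16 L\<^sub>g \<delta>\<^sub>g + 6 \<sigma>\<^sup>2\<close>,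
  the choice \<open>c = M - c\<^sub>2 L\<^sub>f \<ge> 12 c\<^sub>1 L\<^sub>g\<close> (\<open>M\<close> being the clipping level) absorbs the variances
  into the \<open>\<beta>\<close>-terms on the left. The clipped increments of the stepsizes telescope to at most
  \<open>M\<close>, and optimizing over \<open>c\<close> gives the rate. Neither \<open>Z\<^sub>k\<close> nor \<open>M\<^sub>k\<close> is assumed integrable;
  the integrability of \<open>\<Phi>\<^sub>k\<close> is carried along the induction and bounds the negative part
  of \<open>Z\<^sub>k\<close>.
\<close>

subsection \<open>Quadratic norms and the proximal map\<close>

text \<open>The quadratic form attains a positive minimum on the compact Euclidean unit sphere, and
  homogeneity carries the bound to all vectors. It is used to bound the unit sphere of
  \<open>bnorm B\<close>.\<close>

lemma positive_definite_coercive: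
  fixes B :: "real^'n^'n"
  assumes "positive_definite B"
  obtains m where "0 < m" "\<And>x. m * (norm x)\<^sup>2 \<le> (B *v x) \<bullet> x"
proof -
  let ?S = "sphere (0 :: real^'n) 1"
  have cont: "continuous_on ?S (\<lambda>x. (B *v x) \<bullet> x)"
    by (intro continuous_intros matrix_vector_mult_linear_continuous_on)
  have "axis undefined 1 \<in> ?S"
    by (simp add: norm_axis_1)
  then obtain y where y: "y \<in> ?S" "\<And>x. x \<in> ?S \<Longrightarrow> (B *v y) \<bullet> y \<le> (B *v x) \<bullet> x"
    using continuous_attains_inf[OF compact_sphere _ cont] by blast
  show thesis
  proof
    show "0 < (B *v y) \<bullet> y"
      using assms y(1) by (auto simp: positive_definite_def dest!: spec[of _ y])
    fix x :: "real^'n"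
    show "(B *v y) \<bullet> y * (norm x)\<^sup>2 \<le> (B *v x) \<bullet> x"
    proof (cases "x = 0")
      case False
      have "(1 / norm x) *\<^sub>R x \<in> ?S"
        using False by simp
      from y(2)[OF this] have "(B *v y) \<bullet> y \<le> (1 / norm x)\<^sup>2 * ((B *v x) \<bullet> x)"
        by (simp add: matrix_vector_mult_scaleR power2_eq_square)
      then show ?thesis
        using False by (simp add: field_simps)
    qed simp
  qed
qed

lemma positive_definite_nonneg:
  "positive_definite B \<Longrightarrow> 0 \<le> (B *v x) \<bullet> x"
  by (cases "x = 0") (auto simp: positive_definite_def intro: less_imp_le)

lemma bnorm_squared:
  "positive_definite B \<Longrightarrow> (bnorm B x)\<^sup>2 = (B *v x) \<bullet> x"
  by (simp add: bnorm_def positive_definite_nonneg)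

lemma bnorm_nonneg: "positive_definite B \<Longrightarrow> 0 \<le> bnorm B x"
  by (simp add: bnorm_def positive_definite_nonneg)

lemma bnorm_minus: "bnorm B (- x) = bnorm B x"
  using matrix_vector_mult_scaleR[of B "-1" x] by (simp add: bnorm_def)

lemma bnorm_minus_commute: "bnorm B (x - y) = bnorm B (y - x)"
  using bnorm_minus[of B "x - y"] by simp

lemma bnorm_scaleR: "bnorm B (c *\<^sub>R x) = \<bar>c\<bar> * bnorm B x"
  by (simp add: bnorm_def matrix_vector_mult_scaleR real_sqrt_mult flip: mult.assoc)

lemma bnorm_eq_0: "positive_definite B \<Longrightarrow> bnorm B x = 0 \<longleftrightarrow> x = 0"
  by (auto simp: bnorm_def positive_definite_def)

lemma continuous_on_bnorm: "continuous_on S (bnorm B)"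
  unfolding bnorm_def [abs_def]
  by (intro continuous_intros matrix_vector_mult_linear_continuous_on)

lemma symmetric_matrix_inner:
  "positive_definite B \<Longrightarrow> (B *v x) \<bullet> y = (B *v y) \<bullet> x"
  by (metis dot_lmul_matrix inner_commute positive_definite_def transpose_matrix_vector)

lemma bnorm_squared_add:
  "positive_definite B \<Longrightarrow>
    (bnorm B (x + y))\<^sup>2 = (bnorm B x)\<^sup>2 + 2 * ((B *v x) \<bullet> y) + (bnorm B y)\<^sup>2"
  using symmetric_matrix_inner[of B x y]
  by (simp add: bnorm_squared matrix_vector_right_distrib inner_add_left inner_add_right)

section \<open>Dual norm of a positive definite matrix\<close>

context
  fixes B :: "real^'n^'n"
  assumes pd: "positive_definite B"
begin

lemma unit_bnorm_nonempty: "{x. bnorm B x = 1} \<noteq> {}"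
proof -
  define e :: "real^'n" where "e = axis undefined 1"
  have "e \<noteq> 0"
    by (metis e_def norm_axis_1 norm_zero zero_neq_one)
  then have "bnorm B ((1 / bnorm B e) *\<^sub>R e) = 1"
    using bnorm_eq_0[OF pd, of e] bnorm_nonneg[OF pd, of e] by (simp add: bnorm_scaleR)
  then show ?thesis by blast
qed

text \<open>A real \<open>SUP\<close> is meaningful only over a set that is bounded above.
  Coercivity bounds the Euclidean norm on the unit sphere of \<open>bnorm B\<close>, and
  Cauchy-Schwarz does the rest.\<close>

lemma dual_norm_bdd_above: "bdd_above ((\<lambda>x. s \<bullet> x) ` {x. bnorm B x = 1})"
proof -
  obtain m where m: "0 < m" "\<And>x. m * (norm x)\<^sup>2 \<le> (B *v x) \<bullet> x"
    using positive_definite_coercive[OF pd] by blast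
  have "s \<bullet> x \<le> norm s * sqrt (1 / m)" if "bnorm B x = 1" for x
  proof -
    have "m * (norm x)\<^sup>2 \<le> 1"
      using m(2)[of x] that bnorm_squared[OF pd, of x] by simp
    then have "norm x \<le> sqrt (1 / m)"
      using m(1) by (intro real_le_rsqrt) (simp add: field_simps)
    then show ?thesis
      using norm_cauchy_schwarz[of s x] by (meson mult_left_mono norm_ge_zero order_trans)
  qed
  then show ?thesis by (intro bdd_aboveI2) auto
qed

lemma inner_le_dual_norm_unit: "bnorm B x = 1 \<Longrightarrow> s \<bullet> x \<le> dual_norm B s"
  unfolding dual_norm_def by (rule cSUP_upper) (auto intro: dual_norm_bdd_above)

lemma dual_norm_le:
  "(\<And>x. bnorm B x = 1 \<Longrightarrow> s \<bullet> x \<le> c) \<Longrightarrow> dual_norm B s \<le> c"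
  unfolding dual_norm_def by (rule cSUP_least) (use unit_bnorm_nonempty in auto)

lemma dual_norm_nonneg: "0 \<le> dual_norm B s"
proof -
  obtain x where "bnorm B x = 1"
    using unit_bnorm_nonempty by blast
  then show ?thesis
    using inner_le_dual_norm_unit[of x s] inner_le_dual_norm_unit[of "- x" s]
    by (simp add: bnorm_minus)
qed

lemma inner_le_dual_norm: "s \<bullet> x \<le> dual_norm B s * bnorm B x"
proof (cases "x = 0")
  case False
  then have pos: "0 < bnorm B x"
    using bnorm_eq_0[OF pd, of x] bnorm_nonneg[OF pd, of x] by simp
  then have "s \<bullet> ((1 / bnorm B x) *\<^sub>R x) \<le> dual_norm B s"
    by (intro inner_le_dual_norm_unit) (simp add: bnorm_scaleR)
  then show ?thesis
    using pos by (simp add: field_simps)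
qed (simp add: bnorm_def)

lemma abs_inner_le_dual_norm: "\<bar>s \<bullet> x\<bar> \<le> dual_norm B s * bnorm B x"
  using inner_le_dual_norm[of s x] inner_le_dual_norm[of s "- x"]
  by (simp add: bnorm_minus abs_le_iff)

lemma dual_norm_triangle: "dual_norm B (a + b) \<le> dual_norm B a + dual_norm B b"
  by (rule dual_norm_le) (auto simp: inner_add_left intro: add_mono inner_le_dual_norm_unit)

lemma dual_norm_squared_add:
  "(dual_norm B (a + b))\<^sup>2 \<le> 2 * (dual_norm B a)\<^sup>2 + 2 * (dual_norm B b)\<^sup>2"
proof -
  have "(dual_norm B (a + b))\<^sup>2 \<le> (dual_norm B a + dual_norm B b)\<^sup>2"
    by (intro power_mono dual_norm_triangle dual_norm_nonneg)
  also have "\<dots> \<le> 2 * (dual_norm B a)\<^sup>2 + 2 * (dual_norm B b)\<^sup>2"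
    using sum_squares_bound[of "dual_norm B a" "dual_norm B b"]
    by (simp add: power2_sum)
  finally show ?thesis .
qed

text \<open>Convexity serves measurability: a finite convex function on the whole space is
  continuous, hence Borel.\<close>

lemma convex_on_dual_norm: "convex_on UNIV (dual_norm B)"
proof (rule convex_onI)
  fix t :: real and a b :: "real^'n"
  assume t: "0 < t" "t < 1"
  show "dual_norm B ((1 - t) *\<^sub>R a + t *\<^sub>R b) \<le> (1 - t) * dual_norm B a + t * dual_norm B b"
    using t by (intro dual_norm_le)
      (auto simp: inner_add_left intro!: add_mono mult_left_mono inner_le_dual_norm_unit)
qed simp

lemma borel_measurable_dual_norm [measurable]: "dual_norm B \<in> borel_measurable borel"
  by (intro borel_measurable_continuous_onI convex_on_continuous convex_on_dual_norm) simp

end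

section \<open>Proper closed convex functions and the proximal step\<close>

lemma proper_closed_convex_finite:
  assumes "proper_closed_convex \<psi>" "x \<in> edom \<psi>"
  shows "\<psi> x = ereal (real_of_ereal (\<psi> x))"
  using assms by (cases "\<psi> x") (auto simp: proper_closed_convex_def edom_def)

text \<open>The segment between two points of the graph stays in the convex epigraph. This yields
  membership in the domain and convexity of the real values at once.\<close>

lemma proper_closed_convex_combination:
  assumes psi: "proper_closed_convex \<psi>" and x: "x \<in> edom \<psi>" and y: "y \<in> edom \<psi>"
    and t: "0 \<le> t" "t \<le> 1"
  shows "(1 - t) *\<^sub>R x + t *\<^sub>R y \<in> edom \<psi>"
    and "real_of_ereal (\<psi> ((1 - t) *\<^sub>R x + t *\<^sub>R y))
      \<le> (1 - t) * real_of_ereal (\<psi> x) + t * real_of_ereal (\<psi> y)"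
proof -
  let ?z = "(1 - t) *\<^sub>R x + t *\<^sub>R y"
    and ?r = "(1 - t) * real_of_ereal (\<psi> x) + t * real_of_ereal (\<psi> y)"
  have "convex (eepigraph \<psi>)"
    using psi by (simp add: proper_closed_convex_def)
  moreover have "(x, real_of_ereal (\<psi> x)) \<in> eepigraph \<psi>" "(y, real_of_ereal (\<psi> y)) \<in> eepigraph \<psi>"
    using proper_closed_convex_finite[OF psi x] proper_closed_convex_finite[OF psi y]
    by (auto simp: eepigraph_def)
  ultimately have "(1 - t) *\<^sub>R (x, real_of_ereal (\<psi> x)) + t *\<^sub>R (y, real_of_ereal (\<psi> y))
      \<in> eepigraph \<psi>"
    using t by (intro convexD) auto
  then have le: "\<psi> ?z \<le> ereal ?r"
    by (simp add: eepigraph_def)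
  then show z: "?z \<in> edom \<psi>"
    by (auto simp: edom_def)
  show "real_of_ereal (\<psi> ?z) \<le> ?r"
    using le proper_closed_convex_finite[OF psi z] by (metis ereal_less_eq(3))
qed

lemma convex_edom: "proper_closed_convex \<psi> \<Longrightarrow> convex (edom \<psi>)"
  unfolding convex_alt using proper_closed_convex_combination(1) by blast

lemma convex_on_edom:
  "proper_closed_convex \<psi> \<Longrightarrow> convex_on (edom \<psi>) (\<lambda>x. real_of_ereal (\<psi> x))"
  by (intro convex_onI convex_edom) (auto intro: proper_closed_convex_combination(2))

text \<open>The sublevel set at height \<open>t\<close> is the preimage of the closed epigraph under \<open>x \<mapsto> (x, t)\<close>.\<close>

lemma borel_measurable_proper_closed_convex:
  fixes \<psi> :: "real^'n \<Rightarrow> ereal"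
  assumes "proper_closed_convex \<psi>"
  shows "\<psi> \<in> borel_measurable borel"
proof (rule borel_measurable_iff_Iic_ereal[THEN iffD2], intro allI)
  fix a :: ereal
  have "\<psi> -` {..a} \<in> sets borel"
  proof (cases a)
    case (real r)
    have "closed ((\<lambda>x. (x, r)) -` eepigraph \<psi>)"
      using assms by (intro closed_vimage) (auto simp: proper_closed_convex_def intro!: continuous_intros)
    then show ?thesis
      using real by (simp add: eepigraph_def vimage_def)
  next
    case MInf
    then have "\<psi> -` {..a} = {}"
      using assms by (auto simp: proper_closed_convex_def)
    then show ?thesis by simp
  next
    case PInf
    then have "\<psi> -` {..a} = UNIV" by auto
    then show ?thesis by simp
  qed
  then show "\<psi> -` {..a} \<inter> space borel \<in> sets borel"
    by simp
qed

text \<open>Divide by \<open>t\<close> and let it tend to 0. This extracts a first-order optimality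
  condition from minimality along a segment.\<close>

lemma nonneg_of_quadratic_nonneg:
  fixes a b :: real
  assumes "\<And>t. 0 < t \<Longrightarrow> t \<le> 1 \<Longrightarrow> 0 \<le> t * a + t\<^sup>2 * b"
  shows "0 \<le> a"
proof (rule field_le_epsilon)
  fix e :: real
  assume e: "0 < e"
  \<comment> \<open>The second bound gives \<open>t * \<bar>b\<bar> \<le> e\<close>; the summand 1
    keeps the denominator positive when \<open>b = 0\<close>.\<close>
  define t where "t = min 1 (e / (\<bar>b\<bar> + 1))"
  have t: "0 < t" "t \<le> 1" "t \<le> e / (\<bar>b\<bar> + 1)"
    using e by (auto simp: t_def)
  have "0 \<le> t * (a + t * b)"
    using assms[OF t(1,2)] by (simp add: algebra_simps power2_eq_square)
  then have "0 \<le> a + t * b"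
    using t(1) by (simp add: zero_le_mult_iff)
  also have "t * b \<le> t * (\<bar>b\<bar> + 1)"
    using t(1) by (intro mult_left_mono) auto
  also have "\<dots> \<le> e"
    using t(3) by (simp add: field_simps)
  finally show "0 \<le> a + e" by simp
qed

text \<open>Compare the minimizer \<open>y\<close> with the points of the segment from \<open>y\<close> to \<open>z\<close> near \<open>y\<close>.\<close>

lemma Prox_three_point:
  assumes pd: "positive_definite B" and psi: "proper_closed_convex \<psi>"
    and y: "y \<in> Prox B \<psi> x g M" and z: "z \<in> edom \<psi>"
  shows "g \<bullet> y + real_of_ereal (\<psi> y) + M / 2 * (bnorm B (y - x))\<^sup>2 + M / 2 * (bnorm B (y - z))\<^sup>2
    \<le> g \<bullet> z + real_of_ereal (\<psi> z) + M / 2 * (bnorm B (z - x))\<^sup>2"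
proof -
  let ?r = "\<lambda>x. real_of_ereal (\<psi> x)"
  have ydom: "y \<in> edom \<psi>"
    using y by (simp add: Prox_def is_arg_min_def)
  have min: "g \<bullet> y + ?r y + M / 2 * (bnorm B (y - x))\<^sup>2
      \<le> g \<bullet> u + ?r u + M / 2 * (bnorm B (u - x))\<^sup>2" if u: "u \<in> edom \<psi>" for u
  proof -
    have "\<not> ereal (g \<bullet> u) + \<psi> u + ereal (M / 2 * (bnorm B (u - x))\<^sup>2)
        < ereal (g \<bullet> y) + \<psi> y + ereal (M / 2 * (bnorm B (y - x))\<^sup>2)"
      using y u by (auto simp: Prox_def is_arg_min_def)
    moreover obtain r q where "\<psi> u = ereal r" "\<psi> y = ereal q"
      using proper_closed_convex_finite[OF psi u] proper_closed_convex_finite[OF psi ydom] by blast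
    ultimately show ?thesis by simp
  qed
  \<comment> \<open>The increase of the proximal objective from \<open>y\<close> to the point with
    parameter \<open>t\<close> is nonnegative. Convexity of \<open>\<psi>\<close> bounds it by a
    quadratic polynomial in \<open>t\<close>, whose linear coefficient gives the optimality
    condition.\<close>
  have "0 \<le> t * (g \<bullet> (z - y) + ?r z - ?r y + M * ((B *v (y - x)) \<bullet> (z - y)))
      + t\<^sup>2 * (M / 2 * (bnorm B (z - y))\<^sup>2)" if t: "0 < t" "t \<le> 1" for t
  proof -
    let ?u = "(1 - t) *\<^sub>R y + t *\<^sub>R z"
    have u: "?u = y + t *\<^sub>R (z - y)"
      by (simp add: algebra_simps)
    have b: "(bnorm B (?u - x))\<^sup>2 = (bnorm B (y - x))\<^sup>2 + 2 * t * ((B *v (y - x)) \<bullet> (z - y))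
        + t\<^sup>2 * (bnorm B (z - y))\<^sup>2"
      using bnorm_squared_add[OF pd, of "y - x" "t *\<^sub>R (z - y)"]
      unfolding u by (simp add: bnorm_scaleR power_mult_distrib diff_add_eq mult.assoc)
    have i: "g \<bullet> ?u = g \<bullet> y + t * (g \<bullet> (z - y))"
      unfolding u by (simp add: inner_add_right)
    have "g \<bullet> y + ?r y + M / 2 * (bnorm B (y - x))\<^sup>2
        \<le> g \<bullet> ?u + ?r ?u + M / 2 * (bnorm B (?u - x))\<^sup>2"
      using proper_closed_convex_combination(1)[OF psi ydom z] t by (intro min) auto
    also have "\<dots> \<le> g \<bullet> ?u + ((1 - t) * ?r y + t * ?r z) + M / 2 * (bnorm B (?u - x))\<^sup>2"
      using proper_closed_convex_combination(2)[OF psi ydom z, of t] t by simp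
    finally show ?thesis
      unfolding b i by (simp add: algebra_simps)
  qed
  then have "0 \<le> g \<bullet> (z - y) + ?r z - ?r y + M * ((B *v (y - x)) \<bullet> (z - y))"
    by (rule nonneg_of_quadratic_nonneg)
  \<comment> \<open>Expanding \<open>z - x\<close> around \<open>y - x\<close> turns the derivative
    of the quadratic term into a difference of squared distances. The extra term in
    \<open>bnorm B (y - z)\<close> comes from here.\<close>
  moreover have "(bnorm B (z - x))\<^sup>2
      = (bnorm B (y - x))\<^sup>2 + 2 * ((B *v (y - x)) \<bullet> (z - y)) + (bnorm B (y - z))\<^sup>2"
    using bnorm_squared_add[OF pd, of "y - x" "z - y"] by (simp add: bnorm_minus_commute)
  moreover have "g \<bullet> (z - y) = g \<bullet> z - g \<bullet> y"
    by (rule inner_diff_right)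
  ultimately show ?thesis
    by (simp add: distrib_left)
qed

subsection \<open>Expectations and independence\<close>

text \<open>The lower bound \<open>- Z \<le> V\<close> implied by \<open>0 \<le> W\<close> makes the expectation of \<open>Z\<close>
  meaningful, so that \<open>expectation_le\<close> becomes an inequality between integrals.\<close>

lemma expectation_le_dominating:
  fixes W Z V :: "'w \<Rightarrow> real"
  assumes le: "expectation_le P Z (ennreal C)" and C: "0 \<le> C"
    and [measurable]: "Z \<in> borel_measurable P" "W \<in> borel_measurable P"
    and V: "integrable P V"
    and W: "\<And>\<omega>. \<omega> \<in> space P \<Longrightarrow> 0 \<le> W \<omega>" "\<And>\<omega>. \<omega> \<in> space P \<Longrightarrow> W \<omega> \<le> Z \<omega> + V \<omega>"
  shows "integrable P W" and "(\<integral>\<omega>. W \<omega> \<partial>P) \<le> C + (\<integral>\<omega>. V \<omega> \<partial>P)"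
proof -
  let ?pos = "\<integral>\<^sup>+ \<omega>. ennreal (Z \<omega>) \<partial>P" and ?neg = "\<integral>\<^sup>+ \<omega>. ennreal (- Z \<omega>) \<partial>P"
  \<comment> \<open>From \<open>0 \<le> W\<close> and \<open>W \<le> Z + V\<close> follows
    \<open>- Z \<le> V\<close>, so the negative part of \<open>Z\<close> is controlled by the
    integrable \<open>V\<close>.\<close>
  have "?neg \<le> (\<integral>\<^sup>+ \<omega>. ennreal (norm (V \<omega>)) \<partial>P)"
    using W by (intro nn_integral_mono ennreal_leI) fastforce
  also have "\<dots> < \<infinity>"
    using V by (simp add: integrable_iff_bounded)
  finally have neg: "?neg < \<infinity>" .
  have pos_le: "?pos \<le> ennreal C + ?neg"
    using le by (simp add: expectation_le_def)
  \<comment> \<open>Since the bound \<open>C\<close> is finite, the positive part is finite too, and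
    \<open>Z\<close> turns out to be integrable without this having been assumed.\<close>
  then have pos: "?pos < \<infinity>"
    using neg by (auto simp: less_top[symmetric] top_unique)
  have Z: "integrable P Z"
    using neg pos by (simp add: real_integrable_def less_top)
  have "enn2real ?pos \<le> enn2real (ennreal C + ?neg)"
    using pos_le neg by (intro enn2real_mono) auto
  also have "\<dots> = C + enn2real ?neg"
    using neg C by (subst enn2real_plus) auto
  finally have "(\<integral>\<omega>. Z \<omega> \<partial>P) \<le> C"
    by (simp add: real_lebesgue_integral_def[OF Z])
  moreover show int: "integrable P W"
    by (rule Bochner_Integration.integrable_bound[OF Bochner_Integration.integrable_add[OF Z V]])
      (use W in \<open>fastforce intro!: AE_I2\<close>)+
  moreover have "(\<integral>\<omega>. W \<omega> \<partial>P) \<le> (\<integral>\<omega>. Z \<omega> + V \<omega> \<partial>P)"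
    using W Z V int by (intro integral_mono) auto
  ultimately show "(\<integral>\<omega>. W \<omega> \<partial>P) \<le> C + (\<integral>\<omega>. V \<omega> \<partial>P)"
    using Z V by simp
qed

lemma expectation_le_weaken:
  "expectation_le P Z C \<Longrightarrow> C \<le> C' \<Longrightarrow> expectation_le P Z C'"
  unfolding expectation_le_def by (meson add_right_mono order_trans)

section \<open>Seeds that are independent of the past\<close>

lemma sets_vimage_algebra_subset:
  "h \<in> P \<rightarrow>\<^sub>M H \<Longrightarrow> sets (vimage_algebra (space P) h H) \<subseteq> sets P"
  by (auto simp: sets_vimage_algebra2 measurable_space measurable_sets)

lemma sets_vimage_algebra_mono:
  "h' \<in> vimage_algebra X h H \<rightarrow>\<^sub>M H' \<Longrightarrow> sets (vimage_algebra X h' H') \<subseteq> sets (vimage_algebra X h H)"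
  by (auto simp: sets_vimage_algebra2 measurable_def)

text \<open>Independence concerns generated sigma-algebras, so it passes to every random element
  that is measurable for the algebra generated by \<open>h\<close>. Independence from the whole
  history thus yields independence from the quantities computed from it.\<close>

lemma independent_copy_measurable:
  assumes "prob_space P" and copy: "independent_copy P \<Xi> s H h"
    and h': "h' \<in> vimage_algebra (space P) h H \<rightarrow>\<^sub>M H'"
  shows "independent_copy P \<Xi> s H' h'"
proof -
  interpret prob_space P by fact
  have h: "h \<in> P \<rightarrow>\<^sub>M H"
    using copy by (simp add: independent_copy_def)
  have "h' \<in> P \<rightarrow>\<^sub>M H'"
    using measurable_mono[of H' H' "vimage_algebra (space P) h H" P] h' sets_vimage_algebra_subset[OF h]
    by auto
  moreover have "sets (vimage_algebra (space P) h' H') \<subseteq> sets (vimage_algebra (space P) h H)"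
    using h' by (rule sets_vimage_algebra_mono)
  ultimately show ?thesis
    using copy unfolding independent_copy_def indep_sets2_eq by blast
qed

text \<open>Both measures agree on measurable rectangles: independence factors the probability, and
  the seed has law \<open>\<Xi>\<close>. The product form makes Tonelli and Fubini
  available.\<close>

lemma independent_copy_distr_pair:
  assumes "prob_space P" "prob_space \<Xi>" and copy: "independent_copy P \<Xi> s H h"
  shows "distr P (H \<Otimes>\<^sub>M \<Xi>) (\<lambda>\<omega>. (h \<omega>, s \<omega>)) = distr P H h \<Otimes>\<^sub>M \<Xi>"
proof -
  interpret prob_space P by fact
  interpret X: prob_space \<Xi> by fact
  have [measurable]: "h \<in> P \<rightarrow>\<^sub>M H" "s \<in> P \<rightarrow>\<^sub>M \<Xi>"
    and law: "distr P \<Xi> s = \<Xi>"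
    and ind: "indep_set (sets (vimage_algebra (space P) h H)) (sets (vimage_algebra (space P) s \<Xi>))"
    using copy by (auto simp: independent_copy_def)
  interpret H: prob_space "distr P H h"
    by (rule prob_space_distr) simp
  show ?thesis
  proof (rule pair_measure_eqI[symmetric])
    fix A B
    assume "A \<in> sets (distr P H h)" "B \<in> sets \<Xi>"
    then have [measurable]: "A \<in> sets H" "B \<in> sets \<Xi>"
      by auto
    have *: "(\<lambda>\<omega>. (h \<omega>, s \<omega>)) -` (A \<times> B) \<inter> space P = (h -` A \<inter> space P) \<inter> (s -` B \<inter> space P)"
      by auto
    have "prob ((h -` A \<inter> space P) \<inter> (s -` B \<inter> space P))
        = prob (h -` A \<inter> space P) * prob (s -` B \<inter> space P)"
      by (rule indep_setD[OF ind]) (auto intro: in_vimage_algebra)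
    then have "emeasure (distr P (H \<Otimes>\<^sub>M \<Xi>) (\<lambda>\<omega>. (h \<omega>, s \<omega>))) (A \<times> B)
        = emeasure (distr P H h) A * emeasure (distr P \<Xi> s) B"
      by (simp add: emeasure_distr * emeasure_eq_measure ennreal_mult)
    then show "emeasure (distr P H h) A * emeasure \<Xi> B
        = emeasure (distr P (H \<Otimes>\<^sub>M \<Xi>) (\<lambda>\<omega>. (h \<omega>, s \<omega>))) (A \<times> B)"
      by (simp add: law)
  qed (auto intro: H.sigma_finite_measure_axioms X.sigma_finite_measure_axioms)
qed

text \<open>Tonelli for the joint law: the fresh seed is averaged first, with the value of
  \<open>h\<close> frozen.\<close>

lemma independent_copy_nn_integral:
  assumes "prob_space P" "prob_space \<Xi>" and copy: "independent_copy P \<Xi> s H h"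
    and [measurable]: "(\<lambda>(y, t). \<phi> y t) \<in> borel_measurable (H \<Otimes>\<^sub>M \<Xi>)"
  shows "(\<integral>\<^sup>+ \<omega>. \<phi> (h \<omega>) (s \<omega>) \<partial>P) = (\<integral>\<^sup>+ \<omega>. (\<integral>\<^sup>+ t. \<phi> (h \<omega>) t \<partial>\<Xi>) \<partial>P)"
proof -
  interpret X: prob_space \<Xi> by fact
  have [measurable]: "h \<in> P \<rightarrow>\<^sub>M H" "s \<in> P \<rightarrow>\<^sub>M \<Xi>"
    using copy by (auto simp: independent_copy_def)
  have "(\<integral>\<^sup>+ \<omega>. \<phi> (h \<omega>) (s \<omega>) \<partial>P)
      = (\<integral>\<^sup>+ z. \<phi> (fst z) (snd z) \<partial>distr P (H \<Otimes>\<^sub>M \<Xi>) (\<lambda>\<omega>. (h \<omega>, s \<omega>)))"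
    by (subst nn_integral_distr) auto
  also have "\<dots> = (\<integral>\<^sup>+ z. \<phi> (fst z) (snd z) \<partial>(distr P H h \<Otimes>\<^sub>M \<Xi>))"
    by (simp add: independent_copy_distr_pair[OF assms(1-3)])
  also have "\<dots> = (\<integral>\<^sup>+ y. (\<integral>\<^sup>+ t. \<phi> y t \<partial>\<Xi>) \<partial>distr P H h)"
    by (subst X.nn_integral_fst[symmetric]) auto
  also have "\<dots> = (\<integral>\<^sup>+ \<omega>. (\<integral>\<^sup>+ t. \<phi> (h \<omega>) t \<partial>\<Xi>) \<partial>P)"
    by (subst nn_integral_distr) auto
  finally show ?thesis .
qed

text \<open>The Fubini counterpart for signed integrands, used for the gradient noise: it suffices
  that the mean over the seed vanishes for each frozen value of \<open>h\<close>.\<close>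

lemma independent_copy_integral_eq_0:
  fixes \<phi> :: "'h \<Rightarrow> 's \<Rightarrow> real"
  assumes "prob_space P" "prob_space \<Xi>" and copy: "independent_copy P \<Xi> s H h"
    and [measurable]: "(\<lambda>(y, t). \<phi> y t) \<in> borel_measurable (H \<Otimes>\<^sub>M \<Xi>)"
    and int: "integrable P (\<lambda>\<omega>. \<phi> (h \<omega>) (s \<omega>))"
    and zero: "\<And>y. y \<in> space H \<Longrightarrow> (\<integral>t. \<phi> y t \<partial>\<Xi>) = 0"
  shows "(\<integral>\<omega>. \<phi> (h \<omega>) (s \<omega>) \<partial>P) = 0"
proof -
  interpret X: prob_space \<Xi> by fact
  have [measurable]: "h \<in> P \<rightarrow>\<^sub>M H" "s \<in> P \<rightarrow>\<^sub>M \<Xi>"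
    using copy by (auto simp: independent_copy_def)
  interpret H: prob_space "distr P H h"
    using assms(1) by (rule prob_space.prob_space_distr) simp
  interpret pair_sigma_finite "distr P H h" \<Xi> ..
  note joint = independent_copy_distr_pair[OF assms(1-3)]
  have "integrable (distr P (H \<Otimes>\<^sub>M \<Xi>) (\<lambda>\<omega>. (h \<omega>, s \<omega>))) (\<lambda>(y, t). \<phi> y t)"
    using int by (subst integrable_distr_eq) auto
  then have int2: "integrable (distr P H h \<Otimes>\<^sub>M \<Xi>) (\<lambda>(y, t). \<phi> y t)"
    by (simp add: joint)
  have "(\<integral>\<omega>. \<phi> (h \<omega>) (s \<omega>) \<partial>P)
      = (\<integral>z. (\<lambda>(y, t). \<phi> y t) z \<partial>distr P (H \<Otimes>\<^sub>M \<Xi>) (\<lambda>\<omega>. (h \<omega>, s \<omega>)))"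
    by (subst integral_distr) auto
  also have "\<dots> = (\<integral>y. (\<integral>t. \<phi> y t \<partial>\<Xi>) \<partial>distr P H h)"
    unfolding joint using integral_fst'[OF int2] by simp
  also have "\<dots> = 0"
    by (subst Bochner_Integration.integral_cong[OF refl zero]) auto
  finally show ?thesis .
qed

section \<open>Mean and variance of the oracle\<close>

lemma borel_measurable_unbiased_mean:
  assumes "stochastic_oracle \<Xi> g" "unbiased \<Xi> g gbar"
  shows "gbar \<in> borel_measurable borel"
proof -
  interpret prob_space \<Xi>
    using assms by (simp add: stochastic_oracle_def)
  have "(\<lambda>x. \<integral>t. g x t \<partial>\<Xi>) \<in> borel_measurable borel"
    using assms by (intro borel_measurable_lebesgue_integral) (simp add: stochastic_oracle_def)
  moreover have "gbar = (\<lambda>x. \<integral>t. g x t \<partial>\<Xi>)"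
    using assms by (intro ext) (metis unbiased_def has_bochner_integral_integral_eq)
  ultimately show ?thesis by simp
qed

text \<open>The error at \<open>y\<close> is the error of the difference between \<open>y\<close>
  and \<open>z\<close> plus the error at \<open>z\<close>. Squaring the triangle inequality produces
  the factors 2.\<close>

lemma oracle_var_le:
  assumes pd: "positive_definite B" and g: "\<And>y. g y \<in> borel_measurable \<Xi>"
  shows "oracle_var B \<Xi> g gbar y \<le> 2 * oracle_var2 B \<Xi> g gbar y z + 2 * oracle_var B \<Xi> g gbar z"
proof -
  note [measurable] = g borel_measurable_dual_norm[OF pd]
  have "ennreal ((dual_norm B (g y t - gbar y))\<^sup>2)
      \<le> 2 * ennreal ((dual_norm B ((g y t - g z t) - (gbar y - gbar z)))\<^sup>2)
        + 2 * ennreal ((dual_norm B (g z t - gbar z))\<^sup>2)" for t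
  proof -
    have "(dual_norm B (g y t - gbar y))\<^sup>2
        \<le> 2 * (dual_norm B ((g y t - g z t) - (gbar y - gbar z)))\<^sup>2
          + 2 * (dual_norm B (g z t - gbar z))\<^sup>2"
      using dual_norm_squared_add[OF pd, of "(g y t - g z t) - (gbar y - gbar z)" "g z t - gbar z"]
      by (simp add: algebra_simps)
    from ennreal_leI[OF this] show ?thesis
      by (simp add: ennreal_plus ennreal_mult)
  qed
  then have "oracle_var B \<Xi> g gbar y
      \<le> (\<integral>\<^sup>+ t. 2 * ennreal ((dual_norm B ((g y t - g z t) - (gbar y - gbar z)))\<^sup>2)
        + 2 * ennreal ((dual_norm B (g z t - gbar z))\<^sup>2) \<partial>\<Xi>)"
    unfolding oracle_var_def by (intro nn_integral_mono)
  also have "\<dots> = 2 * oracle_var2 B \<Xi> g gbar y z + 2 * oracle_var B \<Xi> g gbar z"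
    unfolding oracle_var_def oracle_var2_def
    by (subst nn_integral_add) (auto simp: nn_integral_cmult)
  finally show ?thesis .
qed

section \<open>Optimal value and the choice of the clipping level\<close>

lemma optimal_value_eq:
  "is_arg_min (objective f \<psi>) (\<lambda>y. y \<in> edom \<psi>) xstar \<Longrightarrow>
    optimal_value f \<psi> = objective f \<psi> xstar"
  unfolding optimal_value_def is_arg_min_def
  by (intro antisym INF_lower INF_greatest) (auto simp: not_less)

lemma real_of_objective:
  "proper_closed_convex \<psi> \<Longrightarrow> y \<in> edom \<psi> \<Longrightarrow>
    real_of_ereal (objective f \<psi> y) = f y + real_of_ereal (\<psi> y)"
  unfolding objective_def
  using proper_closed_convex_finite[of \<psi> y] by (cases "\<psi> y") auto

text \<open>One term of the bound grows linearly in \<open>c\<close>, the other decays like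
  \<open>1 / c\<close>. Instead of minimizing subject to \<open>c0 \<le> c\<close>, the proof adds
  \<open>c0\<close> to the unconstrained balancing point, which costs only the summand with
  \<open>c0\<close> in the conclusion.\<close>

lemma expected_gap_bound_optimized:
  fixes R :: real
  assumes pos: "0 < D" "0 < c1" "0 < c4" "0 < N" and nonneg: "0 \<le> \<sigma>" "0 \<le> c0"
    and R: "\<And>c. 0 < c \<Longrightarrow> c0 \<le> c \<Longrightarrow> R \<le> c4 * (l + c) * D\<^sup>2 / N + 6 * c1 * \<sigma>\<^sup>2 / c + r"
  shows "R \<le> c4 * (l + c0) * D\<^sup>2 / N + 2 * \<sigma> * D * sqrt (6 * c1 * c4 / N) + r"
proof (rule field_le_epsilon)
  fix e :: real
  assume e: "0 < e"
  define q where "q = sqrt (6 * c1 * c4 / N)"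
  have q: "0 < q" "q\<^sup>2 = 6 * c1 * c4 / N"
    using pos by (auto simp: q_def)
  \<comment> \<open>For positive \<open>\<sigma>\<close>, both competing terms equal
    \<open>\<sigma> * D * q\<close> at \<open>c = a\<close>. The increment \<open>b\<close> costs
    exactly \<open>e\<close> and keeps \<open>c\<close> positive when \<open>\<sigma>\<close> and
    \<open>c0\<close> vanish.\<close>
  define a where "a = \<sigma> * q * N / (c4 * D)"
  define b where "b = e * N / (c4 * D\<^sup>2)"
  have a: "0 \<le> a" and b: "0 < b"
    using pos nonneg q e by (auto simp: a_def b_def)
  have "\<sigma> * D * q * a = \<sigma>\<^sup>2 * q\<^sup>2 * N / c4"
    using pos by (simp add: a_def power2_eq_square)
  then have "\<sigma> * D * q * a = 6 * c1 * \<sigma>\<^sup>2"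
    unfolding q(2) using pos by simp
  moreover have "0 \<le> \<sigma> * D * q * (c0 + b)"
    using pos nonneg q b by simp
  ultimately have "6 * c1 * \<sigma>\<^sup>2 \<le> \<sigma> * D * q * (c0 + a + b)"
    by (simp add: distrib_left)
  then have "6 * c1 * \<sigma>\<^sup>2 / (c0 + a + b) \<le> \<sigma> * D * q"
    using a b nonneg by (subst pos_divide_le_eq) auto
  moreover have "c4 * a * D\<^sup>2 / N = \<sigma> * D * q" "c4 * b * D\<^sup>2 / N = e"
    using pos by (simp_all add: a_def b_def power2_eq_square)
  then have "c4 * (l + (c0 + a + b)) * D\<^sup>2 / N = c4 * (l + c0) * D\<^sup>2 / N + \<sigma> * D * q + e"
    by (simp add: distrib_left distrib_right add_divide_distrib)
  moreover have "R \<le> c4 * (l + (c0 + a + b)) * D\<^sup>2 / N + 6 * c1 * \<sigma>\<^sup>2 / (c0 + a + b) + r"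
    using a b nonneg by (intro R) auto
  ultimately show "R \<le> c4 * (l + c0) * D\<^sup>2 / N + 2 * \<sigma> * D * sqrt (6 * c1 * c4 / N) + r + e"
    unfolding q_def[symmetric] by simp
qed

subsection \<open>The iteration\<close>

locale universal_sgd_run =
  fixes B :: "real^'n^'n"
    and f fbar :: "real^'n \<Rightarrow> real" and gbar :: "real^'n \<Rightarrow> real^'n"
    and \<psi> :: "real^'n \<Rightarrow> ereal" and xstar x0 :: "real^'n"
    and \<Xi> :: "'s measure" and g :: "real^'n \<Rightarrow> 's \<Rightarrow> real^'n"
    and upd :: "real \<Rightarrow> real \<Rightarrow> real^'n \<Rightarrow> real^'n \<Rightarrow> real^'n \<Rightarrow> real^'n \<Rightarrow> real"
    and P :: "'w measure" and N :: nat
    and s :: "nat \<Rightarrow> 'w \<Rightarrow> 's" and x :: "nat \<Rightarrow> 'w \<Rightarrow> real^'n" and M :: "nat \<Rightarrow> 'w \<Rightarrow> real"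
    and \<delta>f Lf \<delta>g Lg D \<sigma> c1 c2 c3 c4 :: real
  assumes pd: "positive_definite B"
    and convex_f: "convex_on UNIV f" and psi: "proper_closed_convex \<psi>"
    and xstar: "is_arg_min (objective f \<psi>) (\<lambda>y. y \<in> edom \<psi>) xstar"
    and smooth: "approx_smooth B \<delta>f Lf f fbar gbar"
    and fbar_measurable [measurable]: "fbar \<in> borel_measurable borel"
    and D_pos: "0 < D" and diameter: "\<forall>y \<in> edom \<psi>. \<forall>z \<in> edom \<psi>. bnorm B (y - z) \<le> D"
    and stochastic: "stochastic_oracle \<Xi> g" and unbiased: "unbiased \<Xi> g gbar"
    and \<delta>g_nonneg: "0 \<le> \<delta>g" and Lg_nonneg: "0 \<le> Lg"
    and var2_le: "\<forall>y z. oracle_var2 B \<Xi> g gbar y z \<le> ennreal (2 * Lg * (lin_err f fbar gbar y z + \<delta>g))"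
    and \<sigma>_nonneg: "0 \<le> \<sigma>" and var_xstar: "oracle_var B \<Xi> g gbar xstar = ennreal (\<sigma>\<^sup>2)"
    and c_pos: "0 < c1" "0 < c2" "0 < c3" "0 < c4"
    and prob_P: "prob_space P"
    and upd_measurable:
      "\<forall>\<Omega> > 0. (\<lambda>(m, y, yp, gy, gyp). upd m \<Omega> y yp gy gyp) \<in> borel_measurable borel"
    and requirement: "stepsize_requirement P B f fbar gbar \<psi> \<Xi> g \<delta>f Lf upd c1 c2 c3 c4"
    and N_pos: "1 \<le> N" and x0: "x0 \<in> edom \<psi>"
    and sgd: "universal_sgd P B \<psi> \<Xi> g upd x0 0 N D s x M"
begin

sublocale prob_space P
  by (rule prob_P)

abbreviation \<beta> :: "real^'n \<Rightarrow> real^'n \<Rightarrow> real" where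
  "\<beta> \<equiv> lin_err f fbar gbar"

abbreviation var :: "real^'n \<Rightarrow> ennreal" where
  "var \<equiv> oracle_var B \<Xi> g gbar"

text \<open>Represents the extended-valued objective on \<open>edom \<psi>\<close> only, where its
  values are finite.\<close>

abbreviation F :: "real^'n \<Rightarrow> real" where
  "F y \<equiv> f y + real_of_ereal (\<psi> y)"

abbreviation g_at :: "nat \<Rightarrow> 'w \<Rightarrow> real^'n" where
  "g_at k \<omega> \<equiv> g (x k \<omega>) (s k \<omega>)"

abbreviation history_space :: "nat \<Rightarrow> ((nat \<Rightarrow> real^'n) \<times> (nat \<Rightarrow> 's)) measure" where
  "history_space k \<equiv> (\<Pi>\<^sub>M i\<in>{..k}. borel) \<Otimes>\<^sub>M (\<Pi>\<^sub>M i\<in>{..<k}. \<Xi>)"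

abbreviation history :: "nat \<Rightarrow> 'w \<Rightarrow> (nat \<Rightarrow> real^'n) \<times> (nat \<Rightarrow> 's)" where
  "history k \<omega> \<equiv> (\<lambda>i\<in>{..k}. x i \<omega>, \<lambda>i\<in>{..<k}. s i \<omega>)"

text \<open>The information available just before the query with seed \<open>s k\<close>. The
  coefficient \<open>M k\<close> may depend on \<open>s k\<close>, so it is measurable only for the
  algebra with index \<open>Suc k\<close>.\<close>

abbreviation history_algebra :: "nat \<Rightarrow> 'w measure" where
  "history_algebra k \<equiv> vimage_algebra (space P) (history k) (history_space k)"

section \<open>Measurability and independence along the run\<close>

lemma prob_\<Xi>: "prob_space \<Xi>"
  using stochastic by (simp add: stochastic_oracle_def)

lemma smooth_nonneg: "0 \<le> \<delta>f" "0 \<le> Lf"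
  using smooth by (auto simp: approx_smooth_def)

lemma measurable_oracle [measurable (raw)]:
  "u \<in> borel_measurable A \<Longrightarrow> v \<in> A \<rightarrow>\<^sub>M \<Xi> \<Longrightarrow> (\<lambda>\<omega>. g (u \<omega>) (v \<omega>)) \<in> borel_measurable A"
  using stochastic measurable_compose[of "\<lambda>\<omega>. (u \<omega>, v \<omega>)" A "borel \<Otimes>\<^sub>M \<Xi>" "\<lambda>(y, t). g y t" borel]
  by (simp add: stochastic_oracle_def)

lemma f_measurable [measurable]: "f \<in> borel_measurable borel"
  using convex_f by (intro borel_measurable_continuous_onI convex_on_continuous) auto

lemma gbar_measurable [measurable]: "gbar \<in> borel_measurable borel"
  using stochastic unbiased by (rule borel_measurable_unbiased_mean)

lemma psi_measurable [measurable]: "\<psi> \<in> borel_measurable borel"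
  using psi by (rule borel_measurable_proper_closed_convex)

lemma bnorm_measurable [measurable]: "bnorm B \<in> borel_measurable borel"
  by (intro borel_measurable_continuous_onI continuous_on_bnorm)

lemma dual_norm_measurable [measurable]: "dual_norm B \<in> borel_measurable borel"
  using pd by (rule borel_measurable_dual_norm)

lemma lin_err_measurable [measurable (raw)]:
  assumes [measurable]: "u \<in> borel_measurable A" "v \<in> borel_measurable A"
  shows "(\<lambda>\<omega>. \<beta> (u \<omega>) (v \<omega>)) \<in> borel_measurable A"
  unfolding lin_err_def by measurable

lemma copy: "k \<le> N \<Longrightarrow> independent_copy P \<Xi> (s k) (history_space k) (history k)"
  using sgd by (simp add: universal_sgd_def)

lemma seed_measurable: "k \<le> N \<Longrightarrow> s k \<in> P \<rightarrow>\<^sub>M \<Xi>"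
  using copy[of k] by (simp add: independent_copy_def)

lemma history_measurable: "k \<le> N \<Longrightarrow> history k \<in> P \<rightarrow>\<^sub>M history_space k"
  using copy[of k] by (simp add: independent_copy_def)

lemma history_algebra_measurable:
  assumes "k \<le> N"
  shows "i \<le> k \<Longrightarrow> x i \<in> borel_measurable (history_algebra k)"
    and "i < k \<Longrightarrow> s i \<in> history_algebra k \<rightarrow>\<^sub>M \<Xi>"
proof -
  have hist: "history k \<in> history_algebra k \<rightarrow>\<^sub>M history_space k"
    using measurable_space[OF history_measurable[OF assms]] by (intro measurable_vimage_algebra1) blast
  show "x i \<in> borel_measurable (history_algebra k)" if "i \<le> k"
  proof -
    have "(\<lambda>\<omega>. fst (history k \<omega>) i) \<in> borel_measurable (history_algebra k)"
      using that measurable_compose[OF measurable_compose[OF hist measurable_fst]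
        measurable_component_singleton[of i]] by simp
    then show ?thesis using that by simp
  qed
  show "s i \<in> history_algebra k \<rightarrow>\<^sub>M \<Xi>" if "i < k"
  proof -
    have "(\<lambda>\<omega>. snd (history k \<omega>) i) \<in> history_algebra k \<rightarrow>\<^sub>M \<Xi>"
      using that measurable_compose[OF measurable_compose[OF hist measurable_snd]
        measurable_component_singleton[of i]] by simp
    then show ?thesis using that by simp
  qed
qed

lemma x_measurable: "k \<le> N \<Longrightarrow> x k \<in> borel_measurable P"
  using history_algebra_measurable(1)[of k k]
    measurable_mono[of borel borel "history_algebra k" P]
    sets_vimage_algebra_subset[OF history_measurable[of k]]
  by auto

lemma x_dom: "k \<le> N \<Longrightarrow> \<omega> \<in> space P \<Longrightarrow> x k \<omega> \<in> edom \<psi>"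
  using sgd x0 by (cases k) (auto simp: universal_sgd_def Prox_def is_arg_min_def)

lemma xstar_dom: "xstar \<in> edom \<psi>"
  using xstar by (simp add: is_arg_min_def)

lemma F_xstar_le: "y \<in> edom \<psi> \<Longrightarrow> F xstar \<le> F y"
proof -
  assume y: "y \<in> edom \<psi>"
  have "objective f \<psi> xstar \<le> objective f \<psi> y"
    using xstar y by (auto simp: is_arg_min_def not_less)
  then show ?thesis
    using proper_closed_convex_finite[OF psi y] proper_closed_convex_finite[OF psi xstar_dom]
    unfolding objective_def by (cases "\<psi> y"; cases "\<psi> xstar") auto
qed

lemma lin_err_nonneg: "0 \<le> \<beta> y z"
  using smooth by (simp add: approx_smooth_def)

text \<open>The bounded domain turns the quadratic upper bound into a constant. The integrability of
  \<open>err\<close> and \<open>noise\<close> rests on it.\<close>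

lemma lin_err_dom_le:
  assumes "y \<in> edom \<psi>" "z \<in> edom \<psi>"
  shows "\<beta> y z \<le> Lf / 2 * D\<^sup>2 + \<delta>f"
proof -
  have "\<beta> y z \<le> Lf / 2 * (bnorm B (y - z))\<^sup>2 + \<delta>f"
    using smooth by (simp add: approx_smooth_def)
  also have "\<dots> \<le> Lf / 2 * D\<^sup>2 + \<delta>f"
    using smooth_nonneg diameter assms
    by (intro add_right_mono mult_left_mono power_mono bnorm_nonneg[OF pd]) auto
  finally show ?thesis .
qed

lemma M_Suc:
  "k < N \<Longrightarrow> \<omega> \<in> space P \<Longrightarrow>
    M (Suc k) \<omega> = upd (M k \<omega>) (D\<^sup>2) (x k \<omega>) (x (Suc k) \<omega>) (g_at k \<omega>) (g_at (Suc k) \<omega>)"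
  using sgd by (simp add: universal_sgd_def)

lemma M_0: "\<omega> \<in> space P \<Longrightarrow> M 0 \<omega> = 0"
  using sgd by (simp add: universal_sgd_def)

text \<open>The requirement gives monotonicity only from a nonnegative coefficient. Induction then
  yields \<open>M_nonneg\<close>, which discharges this hypothesis in \<open>M_mono\<close>.\<close>

lemma upd_le:
  assumes "k < N" "\<omega> \<in> space P" "0 \<le> M k \<omega>"
  shows "M k \<omega> \<le> M (Suc k) \<omega>"
proof -
  have "s k \<omega> \<in> space \<Xi>" "s (Suc k) \<omega> \<in> space \<Xi>"
    using assms by (auto intro!: measurable_space[OF seed_measurable])
  then show ?thesis
    using requirement assms x_dom[of k \<omega>] x_dom[of "Suc k" \<omega>] D_pos
    unfolding stepsize_requirement_def M_Suc[OF assms(1,2)] by auto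
qed

lemma M_nonneg: "k \<le> N \<Longrightarrow> \<omega> \<in> space P \<Longrightarrow> 0 \<le> M k \<omega>"
proof (induction k)
  case (Suc k)
  then show ?case
    using upd_le[of k \<omega>] by simp
qed (simp add: M_0)

lemma M_mono: "k < N \<Longrightarrow> \<omega> \<in> space P \<Longrightarrow> M k \<omega> \<le> M (Suc k) \<omega>"
  by (simp add: upd_le M_nonneg)

text \<open>The algebra is a parameter because two instances are used: \<open>P\<close> itself, and
  the history algebra that gives independence from the next seed.\<close>

lemma M_measurable_wrt:
  assumes space: "space A = space P"
  shows "k \<le> N \<Longrightarrow> (\<And>i. i \<le> k \<Longrightarrow> x i \<in> borel_measurable A) \<Longrightarrow>
    (\<And>i. i \<le> k \<Longrightarrow> s i \<in> A \<rightarrow>\<^sub>M \<Xi>) \<Longrightarrow> M k \<in> borel_measurable A"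
proof (induction k)
  case 0
  have "M 0 \<in> borel_measurable A \<longleftrightarrow> (\<lambda>_. 0 :: real) \<in> borel_measurable A"
    by (intro measurable_cong) (simp add: space M_0)
  then show ?case by simp
next
  case (Suc k)
  have [measurable]: "x k \<in> borel_measurable A" "x (Suc k) \<in> borel_measurable A"
    "s k \<in> A \<rightarrow>\<^sub>M \<Xi>" "s (Suc k) \<in> A \<rightarrow>\<^sub>M \<Xi>" "M k \<in> borel_measurable A"
    using Suc by auto
  have "(\<lambda>(m, y, yp, gy, gyp). upd m (D\<^sup>2) y yp gy gyp) \<in> borel_measurable borel"
    using upd_measurable D_pos by simp
  from measurable_compose[OF _ this, of
      "\<lambda>\<omega>. (M k \<omega>, x k \<omega>, x (Suc k) \<omega>, g_at k \<omega>, g_at (Suc k) \<omega>)" A]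
  have "(\<lambda>\<omega>. upd (M k \<omega>) (D\<^sup>2) (x k \<omega>) (x (Suc k) \<omega>) (g_at k \<omega>) (g_at (Suc k) \<omega>))
      \<in> borel_measurable A"
    by simp
  moreover have "M (Suc k) \<in> borel_measurable A \<longleftrightarrow>
      (\<lambda>\<omega>. upd (M k \<omega>) (D\<^sup>2) (x k \<omega>) (x (Suc k) \<omega>) (g_at k \<omega>) (g_at (Suc k) \<omega>))
        \<in> borel_measurable A"
    using Suc.prems(1) by (intro measurable_cong) (simp add: space M_Suc)
  ultimately show ?case by simp
qed

lemma M_measurable: "k \<le> N \<Longrightarrow> M k \<in> borel_measurable P"
  by (rule M_measurable_wrt) (auto intro: x_measurable seed_measurable)

lemma seed_independent_of_point:
  "k \<le> N \<Longrightarrow> independent_copy P \<Xi> (s k) borel (x k)"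
  by (rule independent_copy_measurable[OF prob_P copy history_algebra_measurable(1)]) auto

text \<open>All four components are functions of the history with index \<open>Suc k\<close>, which
  already contains \<open>s k\<close> and therefore determines \<open>M k\<close>.\<close>

lemma next_seed_independent:
  assumes "k < N"
  shows "independent_copy P \<Xi> (s (Suc k)) (borel \<Otimes>\<^sub>M borel \<Otimes>\<^sub>M \<Xi> \<Otimes>\<^sub>M borel)
    (\<lambda>\<omega>. (M k \<omega>, x k \<omega>, s k \<omega>, x (Suc k) \<omega>))"
proof (rule independent_copy_measurable[OF prob_P copy])
  have [measurable]: "x k \<in> borel_measurable (history_algebra (Suc k))"
    "x (Suc k) \<in> borel_measurable (history_algebra (Suc k))"
    "s k \<in> history_algebra (Suc k) \<rightarrow>\<^sub>M \<Xi>"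
    using assms by (auto intro: history_algebra_measurable)
  have [measurable]: "M k \<in> borel_measurable (history_algebra (Suc k))"
    using assms by (intro M_measurable_wrt) (auto intro: history_algebra_measurable)
  show "(\<lambda>\<omega>. (M k \<omega>, x k \<omega>, s k \<omega>, x (Suc k) \<omega>))
      \<in> history_algebra (Suc k) \<rightarrow>\<^sub>M borel \<Otimes>\<^sub>M borel \<Otimes>\<^sub>M \<Xi> \<Otimes>\<^sub>M borel"
    by measurable
qed (use assms in simp)

section \<open>The one-step inequality\<close>

definition Z :: "nat \<Rightarrow> 'w \<Rightarrow> real" where
  "Z k \<omega> = \<beta> (x k \<omega>) (x (Suc k) \<omega>) + (gbar (x k \<omega>) - g_at k \<omega>) \<bullet> (x (Suc k) \<omega> - x k \<omega>)
    - M (Suc k) \<omega> / 2 * (bnorm B (x (Suc k) \<omega> - x k \<omega>))\<^sup>2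
    + (M (Suc k) \<omega> - M k \<omega>) * D\<^sup>2 + \<beta> (x (Suc k) \<omega>) (x k \<omega>)"

definition \<Phi> :: "nat \<Rightarrow> 'w \<Rightarrow> real" where
  "\<Phi> k \<omega> = M k \<omega> / 2 * (bnorm B (x k \<omega> - xstar))\<^sup>2"

definition noise :: "nat \<Rightarrow> 'w \<Rightarrow> real" where
  "noise k \<omega> = (gbar (x k \<omega>) - g_at k \<omega>) \<bullet> (x k \<omega> - xstar)"

definition gap :: "nat \<Rightarrow> 'w \<Rightarrow> real" where
  "gap k \<omega> = F (x k \<omega>) - F xstar"

text \<open>These two linearization errors follow the chain from \<open>x (Suc k)\<close> over
  \<open>x k\<close> to \<open>xstar\<close>, along which the variances are estimated.\<close>

definition err :: "nat \<Rightarrow> 'w \<Rightarrow> real" where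
  "err k \<omega> = \<beta> (x k \<omega>) xstar + \<beta> (x (Suc k) \<omega>) (x k \<omega>)"

lemma run_measurable:
  "k \<le> N \<Longrightarrow> \<Phi> k \<in> borel_measurable P" "k \<le> N \<Longrightarrow> noise k \<in> borel_measurable P"
  "k \<le> N \<Longrightarrow> gap k \<in> borel_measurable P"
  "k < N \<Longrightarrow> err k \<in> borel_measurable P" "k < N \<Longrightarrow> Z k \<in> borel_measurable P"
proof -
  note [measurable] = x_measurable seed_measurable M_measurable
  show "k \<le> N \<Longrightarrow> \<Phi> k \<in> borel_measurable P" "k \<le> N \<Longrightarrow> noise k \<in> borel_measurable P"
    "k \<le> N \<Longrightarrow> gap k \<in> borel_measurable P"
    unfolding \<Phi>_def [abs_def] noise_def [abs_def] gap_def [abs_def] by measurable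
  assume "k < N"
  then have [simp]: "k \<le> N" "Suc k \<le> N" by auto
  show "err k \<in> borel_measurable P" "Z k \<in> borel_measurable P"
    unfolding err_def [abs_def] Z_def [abs_def] by measurable
qed

text \<open>This is the three-point inequality at \<open>xstar\<close>, with \<open>M k\<close>
  replaced by \<open>M (Suc k)\<close> in the terms with \<open>r\<close> and \<open>dp\<close>, and
  with \<open>\<beta> yp y\<close> added to both sides.\<close>

lemma one_step:
  assumes k: "k < N" and \<omega>: "\<omega> \<in> space P"
  shows "gap (Suc k) \<omega> + err k \<omega> + \<Phi> (Suc k) \<omega> \<le> Z k \<omega> + (\<Phi> k \<omega> + noise k \<omega>)"
proof -
  define y where "y = x k \<omega>"
  define yp where "yp = x (Suc k) \<omega>"
  define h where "h = g_at k \<omega>"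
  define r where "r = (bnorm B (yp - y))\<^sup>2"
  define d where "d = (bnorm B (y - xstar))\<^sup>2"
  define dp where "dp = (bnorm B (yp - xstar))\<^sup>2"
  have dom: "y \<in> edom \<psi>" "yp \<in> edom \<psi>"
    using k \<omega> by (auto simp: y_def yp_def intro: x_dom)
  have "r \<le> D\<^sup>2" "dp \<le> D\<^sup>2"
    using dom xstar_dom diameter by (auto simp: r_def dp_def intro!: power_mono bnorm_nonneg[OF pd])
  \<comment> \<open>Raising the coefficient costs half the increment times \<open>r + dp\<close>.
    Both squared distances are at most \<open>D\<^sup>2\<close>, so the term with
    \<open>D\<^sup>2\<close> in \<open>Z\<close> pays for it.\<close>
  then have "0 \<le> (M (Suc k) \<omega> - M k \<omega>) * (D\<^sup>2 - r / 2 - dp / 2)"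
    using M_mono[OF k \<omega>] by (intro mult_nonneg_nonneg) auto
  moreover have "yp \<in> Prox B \<psi> y h (M k \<omega>)"
    using sgd k \<omega> by (simp add: universal_sgd_def y_def yp_def h_def)
  from Prox_three_point[OF pd psi this xstar_dom]
  have "h \<bullet> yp + real_of_ereal (\<psi> yp) + M k \<omega> / 2 * r + M k \<omega> / 2 * dp
      \<le> h \<bullet> xstar + real_of_ereal (\<psi> xstar) + M k \<omega> / 2 * d"
    by (simp add: r_def dp_def d_def bnorm_minus_commute[of B xstar])
  \<comment> \<open>Both \<open>f yp\<close> and \<open>f xstar\<close> are linearized at
    \<open>y\<close>, so \<open>fbar y\<close> cancels. Splitting \<open>yp - xstar\<close> at
    \<open>y\<close> separates the noise from the part that belongs to \<open>Z\<close>.\<close>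
  ultimately have "gap (Suc k) \<omega> + \<beta> y xstar + M (Suc k) \<omega> / 2 * dp
      \<le> \<beta> y yp + (gbar y - h) \<bullet> (yp - y) - M (Suc k) \<omega> / 2 * r
        + (M (Suc k) \<omega> - M k \<omega>) * D\<^sup>2 + (M k \<omega> / 2 * d + (gbar y - h) \<bullet> (y - xstar))"
    unfolding gap_def lin_err_def yp_def[symmetric]
    by (simp add: inner_diff_left inner_diff_right algebra_simps)
  then show ?thesis
    unfolding err_def Z_def \<Phi>_def noise_def y_def[symmetric] yp_def[symmetric] h_def[folded y_def, symmetric]
      r_def[symmetric] d_def[symmetric] dp_def[symmetric]
    by simp
qed

section \<open>Variance bounds and the gradient noise\<close>

lemma var_le: "var y \<le> ennreal (4 * Lg * (\<beta> y z + \<delta>g)) + 2 * var z"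
proof -
  have "g y \<in> borel_measurable \<Xi>" for y
    by measurable
  then have "var y \<le> 2 * oracle_var2 B \<Xi> g gbar y z + 2 * var z"
    by (intro oracle_var_le[OF pd])
  also have "\<dots> \<le> 2 * ennreal (2 * Lg * (\<beta> y z + \<delta>g)) + 2 * var z"
    using var2_le by (intro add_right_mono mult_left_mono) auto
  also have "2 * ennreal (2 * Lg * (\<beta> y z + \<delta>g)) = ennreal (2 * (2 * Lg * (\<beta> y z + \<delta>g)))"
    using lin_err_nonneg[of y z] \<delta>g_nonneg Lg_nonneg by (subst ennreal_mult) auto
  finally show ?thesis by (simp add: mult.assoc)
qed

lemma var_le_xstar: "var y \<le> ennreal (4 * Lg * (\<beta> y xstar + \<delta>g) + 2 * \<sigma>\<^sup>2)"
  using var_le[of y xstar] lin_err_nonneg[of y xstar] \<delta>g_nonneg Lg_nonneg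
  by (simp add: var_xstar ennreal_mult)

text \<open>The variance at \<open>yp\<close> is estimated through \<open>y\<close> rather than
  \<open>xstar\<close>, because \<open>\<beta> yp xstar\<close> does not occur in
  \<open>one_step\<close>. This leaves \<open>?w\<close> plus three times the bound
  \<open>?v\<close> for \<open>var y\<close>, hence the constants 12, 16 and 6.\<close>

lemma var_sum_le:
  "var yp + var y
    \<le> ennreal (12 * Lg * (\<beta> y xstar + \<beta> yp y) + 16 * Lg * \<delta>g + 6 * \<sigma>\<^sup>2)"
proof -
  let ?v = "4 * Lg * (\<beta> y xstar + \<delta>g) + 2 * \<sigma>\<^sup>2" and ?w = "4 * Lg * (\<beta> yp y + \<delta>g)"
  have nonneg: "0 \<le> ?v" "0 \<le> ?w"
    using lin_err_nonneg[of y xstar] lin_err_nonneg[of yp y] \<delta>g_nonneg Lg_nonneg by auto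
  have "var yp + var y \<le> (ennreal ?w + 2 * var y) + var y"
    by (intro add_right_mono var_le)
  also have "\<dots> \<le> (ennreal ?w + 2 * ennreal ?v) + ennreal ?v"
    by (intro add_mono mult_left_mono var_le_xstar) auto
  also have "\<dots> = ennreal (?w + 2 * ?v + ?v)"
    using nonneg by (simp add: ennreal_mult del: distrib_left_numeral)
  also have "\<dots> \<le> ennreal (12 * Lg * (\<beta> y xstar + \<beta> yp y) + 16 * Lg * \<delta>g + 6 * \<sigma>\<^sup>2)"
    using lin_err_nonneg[of yp y] Lg_nonneg by (intro ennreal_leI) (simp add: algebra_simps)
  finally show ?thesis .
qed

text \<open>Averaging over the fresh seed turns the second moment of the gradient error into the
  mean of \<open>var (x k \<omega>)\<close>, which is bounded on the domain. A square-integrable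
  error paired with a bounded vector is integrable.\<close>

lemma noise_integrable:
  assumes k: "k \<le> N"
  shows "integrable P (noise k)"
proof -
  note [measurable] = x_measurable[OF k] seed_measurable[OF k] run_measurable(2)[OF k]
  let ?e = "\<lambda>\<omega>. dual_norm B (g_at k \<omega> - gbar (x k \<omega>))"
  let ?K = "4 * Lg * (Lf / 2 * D\<^sup>2 + \<delta>f + \<delta>g) + 2 * \<sigma>\<^sup>2"
  have "(\<integral>\<^sup>+ \<omega>. ennreal ((?e \<omega>)\<^sup>2) \<partial>P) = (\<integral>\<^sup>+ \<omega>. var (x k \<omega>) \<partial>P)"
    unfolding oracle_var_def
    by (rule independent_copy_nn_integral[OF prob_P prob_\<Xi> seed_independent_of_point[OF k],
        where \<phi> = "\<lambda>y t. ennreal ((dual_norm B (g y t - gbar y))\<^sup>2)"]) measurable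
  also have "\<dots> \<le> (\<integral>\<^sup>+ \<omega>. ennreal ?K \<partial>P)"
  proof (rule nn_integral_mono)
    fix \<omega> assume "\<omega> \<in> space P"
    then have "\<beta> (x k \<omega>) xstar \<le> Lf / 2 * D\<^sup>2 + \<delta>f"
      using k by (intro lin_err_dom_le x_dom xstar_dom)
    then show "var (x k \<omega>) \<le> ennreal ?K"
      using Lg_nonneg
      by (intro order_trans[OF var_le_xstar] ennreal_leI add_right_mono mult_left_mono) auto
  qed
  also have "\<dots> < \<infinity>"
    by (simp add: emeasure_space_1)
  finally have "integrable P (\<lambda>\<omega>. (?e \<omega>)\<^sup>2)"
    by (intro integrableI_bounded) auto
  then have "integrable P (\<lambda>\<omega>. (?e \<omega>)\<^sup>2 + D\<^sup>2)"
    by simp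
  then show ?thesis
  proof (rule Bochner_Integration.integrable_bound)
    show "AE \<omega> in P. norm (noise k \<omega>) \<le> norm ((?e \<omega>)\<^sup>2 + D\<^sup>2)"
    proof (rule AE_I2)
      fix \<omega> assume "\<omega> \<in> space P"
      then have d: "bnorm B (x k \<omega> - xstar) \<le> D"
        using diameter k xstar_dom x_dom by auto
      have e: "0 \<le> ?e \<omega>"
        by (rule dual_norm_nonneg[OF pd])
      have "noise k \<omega> = - ((g_at k \<omega> - gbar (x k \<omega>)) \<bullet> (x k \<omega> - xstar))"
        unfolding noise_def by (simp flip: inner_minus_left)
      then have "\<bar>noise k \<omega>\<bar> \<le> ?e \<omega> * bnorm B (x k \<omega> - xstar)"
        using abs_inner_le_dual_norm[OF pd, of "g_at k \<omega> - gbar (x k \<omega>)" "x k \<omega> - xstar"] by simp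
      also have "\<dots> \<le> ?e \<omega> * D"
        using d e by (rule mult_left_mono)
      also have "\<dots> \<le> (?e \<omega>)\<^sup>2 + D\<^sup>2"
        using sum_squares_bound[of "?e \<omega>" D] mult_nonneg_nonneg[OF e less_imp_le[OF D_pos]] by linarith
      finally show "norm (noise k \<omega>) \<le> norm ((?e \<omega>)\<^sup>2 + D\<^sup>2)"
        by simp
    qed
  qed measurable
qed

text \<open>The error is paired with \<open>x k\<close>, which is independent of \<open>s k\<close>,
  and not with \<open>x (Suc k)\<close>, which may depend on it. With the point frozen, unbiasedness
  makes the mean over the seed vanish.\<close>

lemma noise_integral:
  assumes k: "k \<le> N"
  shows "(\<integral>\<omega>. noise k \<omega> \<partial>P) = 0"
proof -
  interpret X: prob_space \<Xi> by (rule prob_\<Xi>)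
  have "(\<integral>t. (gbar y - g y t) \<bullet> (y - xstar) \<partial>\<Xi>) = 0" for y
  proof -
    have "has_bochner_integral \<Xi> (g y) (gbar y)"
      using unbiased by (simp add: unbiased_def)
    then have "integrable \<Xi> (g y)" "(\<integral>t. g y t \<partial>\<Xi>) = gbar y"
      by (auto simp: has_bochner_integral_iff)
    then show ?thesis
      by (simp add: X.prob_space)
  qed
  then show ?thesis
    using noise_integrable[OF k] unfolding noise_def
    by (intro independent_copy_integral_eq_0[OF prob_P prob_\<Xi> seed_independent_of_point[OF k],
        where \<phi> = "\<lambda>y t. (gbar y - g y t) \<bullet> (y - xstar)"]) auto
qed

section \<open>Expected recursion and telescoping\<close>

lemma requirement_step:
  assumes k: "k < N" and Mbar: "c2 * Lf < Mbar"
  shows "expectation_le P (Z k)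
    (ennreal (c1 / (Mbar - c2 * Lf)) * (\<integral>\<^sup>+ \<omega>. var (x (Suc k) \<omega>) + var (x k \<omega>) \<partial>P)
      + ennreal (c3 * \<delta>f)
      + ennreal c4 * (\<integral>\<^sup>+ \<omega>. ennreal (max 0 (min (M (Suc k) \<omega>) Mbar - M k \<omega>) * D\<^sup>2) \<partial>P))"
proof -
  have dom: "\<forall>\<omega>\<in>space P. 0 \<le> M k \<omega> \<and> x k \<omega> \<in> edom \<psi> \<and> x (Suc k) \<omega> \<in> edom \<psi>"
    using k by (auto intro: M_nonneg x_dom)
  have D2: "0 < D\<^sup>2"
    using D_pos by simp
  have kN: "k \<le> N" "Suc k \<le> N"
    using k by auto
  \<comment> \<open>With \<open>D\<^sup>2\<close> for the constant, \<open>M_Suc\<close> identifies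
    the updated coefficient and the bounded random variable becomes \<open>Z k\<close>.\<close>
  note R = requirement[unfolded stepsize_requirement_def Let_def, THEN conjunct2, rule_format,
    OF D2 Mbar M_measurable[OF kN(1)] x_measurable[OF kN(1)] x_measurable[OF kN(2)] dom[rule_format]
      seed_independent_of_point[OF kN(1)] next_seed_independent[OF k]]
  show ?thesis
    using R unfolding expectation_le_def Z_def
    by (simp add: M_Suc[OF k] cong: nn_integral_cong)
qed

text \<open>By monotonicity both sides vanish once \<open>M k\<close> has reached the level
  \<open>Mbar\<close>. The increments of the clipped sequence telescope, and clipped coefficients
  are bounded and hence integrable.\<close>

lemma clipped_increment:
  assumes "k < N" "\<omega> \<in> space P" "0 \<le> Mbar"
  shows "max 0 (min (M (Suc k) \<omega>) Mbar - M k \<omega>) = min (M (Suc k) \<omega>) Mbar - min (M k \<omega>) Mbar"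
  using M_mono[OF assms(1,2)] by auto

lemma clipped_integrable:
  assumes "k \<le> N" "0 \<le> Mbar"
  shows "integrable P (\<lambda>\<omega>. min (M k \<omega>) Mbar)"
  using M_nonneg[OF assms(1)] M_measurable[OF assms(1)] assms(2)
  by (intro integrable_const_bound[of _ Mbar]) auto

lemma err_nonneg: "0 \<le> err k \<omega>"
  by (simp add: err_def lin_err_nonneg)

lemma err_integrable:
  assumes k: "k < N"
  shows "integrable P (err k)"
proof (rule integrable_const_bound)
  show "AE \<omega> in P. norm (err k \<omega>) \<le> 2 * (Lf / 2 * D\<^sup>2 + \<delta>f)"
  proof (rule AE_I2)
    fix \<omega> assume "\<omega> \<in> space P"
    then have "x k \<omega> \<in> edom \<psi>" "x (Suc k) \<omega> \<in> edom \<psi>"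
      using k by (auto intro: x_dom)
    then have "err k \<omega> \<le> 2 * (Lf / 2 * D\<^sup>2 + \<delta>f)"
      unfolding err_def
      using lin_err_dom_le[of "x k \<omega>" xstar] lin_err_dom_le[of "x (Suc k) \<omega>" "x k \<omega>"] xstar_dom
      by simp
    then show "norm (err k \<omega>) \<le> 2 * (Lf / 2 * D\<^sup>2 + \<delta>f)"
      using err_nonneg[of k \<omega>] by simp
  qed
qed (rule run_measurable(4)[OF k])

lemma \<Phi>_nonneg: "k \<le> N \<Longrightarrow> \<omega> \<in> space P \<Longrightarrow> 0 \<le> \<Phi> k \<omega>"
  by (simp add: \<Phi>_def M_nonneg)

lemma gap_nonneg: "k \<le> N \<Longrightarrow> \<omega> \<in> space P \<Longrightarrow> 0 \<le> gap k \<omega>"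
  using F_xstar_le[OF x_dom] by (simp add: gap_def)

text \<open>Here \<open>c\<close> is the excess of the clipping level over \<open>c2 * Lf\<close>.
  The condition on \<open>c\<close> lets the expected \<open>err\<close> on the left of
  \<open>one_step\<close> absorb the variance contribution on the right.\<close>

lemma expected_step:
  assumes k: "k < N" and c: "0 < c" "12 * c1 * Lg \<le> c"
    and \<Phi>: "integrable P (\<Phi> k)"
  shows "integrable P (gap (Suc k))" "integrable P (\<Phi> (Suc k))"
    and "(\<integral>\<omega>. gap (Suc k) \<omega> \<partial>P) + (\<integral>\<omega>. \<Phi> (Suc k) \<omega> \<partial>P)
      \<le> (\<integral>\<omega>. \<Phi> k \<omega> \<partial>P) + (6 * c1 * \<sigma>\<^sup>2 / c + c3 * \<delta>f + 4 / 3 * \<delta>g)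
        + c4 * D\<^sup>2 * ((\<integral>\<omega>. min (M (Suc k) \<omega>) (c2 * Lf + c) \<partial>P)
                     - (\<integral>\<omega>. min (M k \<omega>) (c2 * Lf + c) \<partial>P))"
proof -
  define Mbar where "Mbar = c2 * Lf + c"
  have Mbar: "c2 * Lf < Mbar" "0 \<le> Mbar"
    using c c_pos smooth_nonneg by (auto simp: Mbar_def)
  have kN: "k \<le> N" "Suc k \<le> N"
    using k by auto
  note [measurable] = run_measurable(1,3)[OF kN(2)] run_measurable(4,5)[OF k]
  let ?v = "\<lambda>\<omega>. 12 * Lg * err k \<omega> + 16 * Lg * \<delta>g + 6 * \<sigma>\<^sup>2"
  let ?T = "\<lambda>\<omega>. (min (M (Suc k) \<omega>) Mbar - min (M k \<omega>) Mbar) * D\<^sup>2"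
  let ?W = "\<lambda>\<omega>. gap (Suc k) \<omega> + err k \<omega> + \<Phi> (Suc k) \<omega>"
  let ?C = "c1 / c * (\<integral>\<omega>. ?v \<omega> \<partial>P) + c3 * \<delta>f + c4 * (\<integral>\<omega>. ?T \<omega> \<partial>P)"
  have v: "integrable P ?v" "\<And>\<omega>. 0 \<le> ?v \<omega>"
    using err_integrable[OF k] err_nonneg[of k] Lg_nonneg \<delta>g_nonneg by auto
  have T: "integrable P ?T"
    using clipped_integrable[OF kN(1) Mbar(2)] clipped_integrable[OF kN(2) Mbar(2)] by simp
  have T_nonneg: "0 \<le> ?T \<omega>" if "\<omega> \<in> space P" for \<omega>
    using min.mono[OF M_mono[OF k that] order_refl[of Mbar]] by simp
  have vint: "0 \<le> (\<integral>\<omega>. ?v \<omega> \<partial>P)" and Tint: "0 \<le> (\<integral>\<omega>. ?T \<omega> \<partial>P)"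
    by (intro Bochner_Integration.integral_nonneg v(2) T_nonneg; assumption)+
  have "(\<integral>\<^sup>+ \<omega>. var (x (Suc k) \<omega>) + var (x k \<omega>) \<partial>P) \<le> (\<integral>\<^sup>+ \<omega>. ennreal (?v \<omega>) \<partial>P)"
    unfolding err_def by (intro nn_integral_mono var_sum_le)
  also have "\<dots> = ennreal (\<integral>\<omega>. ?v \<omega> \<partial>P)"
    using v by (intro nn_integral_eq_integral) auto
  finally have var: "(\<integral>\<^sup>+ \<omega>. var (x (Suc k) \<omega>) + var (x k \<omega>) \<partial>P) \<le> ennreal (\<integral>\<omega>. ?v \<omega> \<partial>P)" .
  have "(\<integral>\<^sup>+ \<omega>. ennreal (max 0 (min (M (Suc k) \<omega>) Mbar - M k \<omega>) * D\<^sup>2) \<partial>P)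
      = (\<integral>\<^sup>+ \<omega>. ennreal (?T \<omega>) \<partial>P)"
    by (intro nn_integral_cong) (simp add: clipped_increment[OF k _ Mbar(2)])
  also have "\<dots> = ennreal (\<integral>\<omega>. ?T \<omega> \<partial>P)"
    using T T_nonneg by (intro nn_integral_eq_integral) auto
  finally have clip: "(\<integral>\<^sup>+ \<omega>. ennreal (max 0 (min (M (Suc k) \<omega>) Mbar - M k \<omega>) * D\<^sup>2) \<partial>P)
      = ennreal (\<integral>\<omega>. ?T \<omega> \<partial>P)" .
  have ennreal_C: "ennreal a * ennreal b + ennreal d + ennreal a' * ennreal b' = ennreal (a * b + d + a' * b')"
    if "0 \<le> a" "0 \<le> b" "0 \<le> d" "0 \<le> a'" "0 \<le> b'" for a b d a' b'
    using that by (simp add: ennreal_mult)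
  have "expectation_le P (Z k) (ennreal (c1 / c) * ennreal (\<integral>\<omega>. ?v \<omega> \<partial>P) + ennreal (c3 * \<delta>f)
      + ennreal c4 * ennreal (\<integral>\<omega>. ?T \<omega> \<partial>P))"
    using requirement_step[OF k Mbar(1)] var unfolding clip
    by (rule_tac expectation_le_weaken) (auto simp: Mbar_def intro!: add_right_mono mult_left_mono)
  also have "ennreal (c1 / c) * ennreal (\<integral>\<omega>. ?v \<omega> \<partial>P) + ennreal (c3 * \<delta>f)
      + ennreal c4 * ennreal (\<integral>\<omega>. ?T \<omega> \<partial>P) = ennreal ?C"
    using vint Tint c c_pos smooth_nonneg by (intro ennreal_C) simp_all
  finally have le: "expectation_le P (Z k) (ennreal ?C)" .
  have C: "0 \<le> ?C"
    using vint Tint c c_pos smooth_nonneg by (intro add_nonneg_nonneg mult_nonneg_nonneg) auto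
  have W: "0 \<le> ?W \<omega>" "?W \<omega> \<le> Z k \<omega> + (\<Phi> k \<omega> + noise k \<omega>)" if "\<omega> \<in> space P" for \<omega>
    using gap_nonneg[OF kN(2) that] err_nonneg[of k \<omega>] \<Phi>_nonneg[OF kN(2) that] one_step[OF k that]
    by auto
  have V: "integrable P (\<lambda>\<omega>. \<Phi> k \<omega> + noise k \<omega>)"
    using \<Phi> noise_integrable[OF kN(1)] by simp
  have "?W \<in> borel_measurable P"
    by measurable
  note dominating = expectation_le_dominating[OF le C run_measurable(5)[OF k] this V W]
  \<comment> \<open>All summands of \<open>?W\<close> are nonnegative, so each is dominated by the
    integrable \<open>?W\<close>. For \<open>\<Phi>\<close> this is what keeps the induction
    going.\<close>
  show gap: "integrable P (gap (Suc k))"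
    using gap_nonneg[OF kN(2)] err_nonneg \<Phi>_nonneg[OF kN(2)]
    by (intro Bochner_Integration.integrable_bound[OF dominating(1)]) (auto intro!: AE_I2)
  show \<Phi>': "integrable P (\<Phi> (Suc k))"
    using gap_nonneg[OF kN(2)] err_nonneg \<Phi>_nonneg[OF kN(2)]
    by (intro Bochner_Integration.integrable_bound[OF dominating(1)]) (auto intro!: AE_I2)
  define E where "E = (\<integral>\<omega>. err k \<omega> \<partial>P)"
  have E: "0 \<le> E"
    unfolding E_def by (intro Bochner_Integration.integral_nonneg err_nonneg)
  have "(\<integral>\<omega>. ?v \<omega> \<partial>P) = 12 * Lg * E + 16 * Lg * \<delta>g + 6 * \<sigma>\<^sup>2"
    using err_integrable[OF k] by (simp add: E_def prob_space)
  then have "c1 / c * (\<integral>\<omega>. ?v \<omega> \<partial>P)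
      = 12 * c1 * Lg / c * (E + 4 / 3 * \<delta>g) + 6 * c1 * \<sigma>\<^sup>2 / c"
    using c by (simp add: field_simps)
  \<comment> \<open>The factor is at most 1 by the choice of \<open>c\<close>. The ratio 16/12 is
    the source of \<open>4 / 3 * \<delta>g\<close>, and \<open>E\<close> cancels against the
    left-hand side.\<close>
  also have "\<dots> \<le> 1 * (E + 4 / 3 * \<delta>g) + 6 * c1 * \<sigma>\<^sup>2 / c"
    using c E \<delta>g_nonneg by (intro add_right_mono mult_right_mono) auto
  finally have "c1 / c * (\<integral>\<omega>. ?v \<omega> \<partial>P) \<le> E + 4 / 3 * \<delta>g + 6 * c1 * \<sigma>\<^sup>2 / c"
    by simp
  moreover have "(\<integral>\<omega>. ?W \<omega> \<partial>P) = (\<integral>\<omega>. gap (Suc k) \<omega> \<partial>P) + E + (\<integral>\<omega>. \<Phi> (Suc k) \<omega> \<partial>P)"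
    using gap \<Phi>' err_integrable[OF k] by (simp add: E_def)
  moreover have "(\<integral>\<omega>. \<Phi> k \<omega> + noise k \<omega> \<partial>P) = (\<integral>\<omega>. \<Phi> k \<omega> \<partial>P)"
    using \<Phi> noise_integrable[OF kN(1)] noise_integral[OF kN(1)] by simp
  moreover have "c4 * (\<integral>\<omega>. ?T \<omega> \<partial>P)
      = c4 * D\<^sup>2 * ((\<integral>\<omega>. min (M (Suc k) \<omega>) Mbar \<partial>P) - (\<integral>\<omega>. min (M k \<omega>) Mbar \<partial>P))"
    using clipped_integrable[OF kN(1) Mbar(2)] clipped_integrable[OF kN(2) Mbar(2)] by simp
  ultimately show "(\<integral>\<omega>. gap (Suc k) \<omega> \<partial>P) + (\<integral>\<omega>. \<Phi> (Suc k) \<omega> \<partial>P)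
      \<le> (\<integral>\<omega>. \<Phi> k \<omega> \<partial>P) + (6 * c1 * \<sigma>\<^sup>2 / c + c3 * \<delta>f + 4 / 3 * \<delta>g)
        + c4 * D\<^sup>2 * ((\<integral>\<omega>. min (M (Suc k) \<omega>) (c2 * Lf + c) \<partial>P)
                     - (\<integral>\<omega>. min (M k \<omega>) (c2 * Lf + c) \<partial>P))"
    using dominating(2) unfolding Mbar_def by linarith
qed

text \<open>Integrability belongs to the induction claim because each step needs it for
  \<open>\<Phi> n\<close>. The start is trivial: \<open>M 0\<close> is zero, so the potential and
  the clipped coefficient vanish.\<close>

lemma expected_telescope:
  assumes c: "0 < c" "12 * c1 * Lg \<le> c" and "n \<le> N"
  shows "integrable P (\<Phi> n) \<and> (\<forall>k\<in>{1..n}. integrable P (gap k)) \<and>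
    (\<Sum>k=1..n. \<integral>\<omega>. gap k \<omega> \<partial>P) + (\<integral>\<omega>. \<Phi> n \<omega> \<partial>P)
      \<le> real n * (6 * c1 * \<sigma>\<^sup>2 / c + c3 * \<delta>f + 4 / 3 * \<delta>g)
        + c4 * D\<^sup>2 * (\<integral>\<omega>. min (M n \<omega>) (c2 * Lf + c) \<partial>P)"
  using \<open>n \<le> N\<close>
proof (induction n)
  case 0
  have "integrable P (\<Phi> 0) \<longleftrightarrow> integrable P (\<lambda>_. 0 :: real)"
    by (intro Bochner_Integration.integrable_cong) (auto simp: \<Phi>_def M_0)
  moreover have "(\<integral>\<omega>. \<Phi> 0 \<omega> \<partial>P) = (\<integral>\<omega>. 0 \<partial>P)"
    by (intro Bochner_Integration.integral_cong) (auto simp: \<Phi>_def M_0)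
  moreover have "(\<integral>\<omega>. min (M 0 \<omega>) (c2 * Lf + c) \<partial>P) = (\<integral>\<omega>. 0 \<partial>P)"
    using c c_pos smooth_nonneg by (intro Bochner_Integration.integral_cong) (auto simp: M_0)
  ultimately show ?case by simp
next
  case (Suc n)
  then have n: "n < N" and \<Phi>: "integrable P (\<Phi> n)"
    by auto
  define K where "K = 6 * c1 * \<sigma>\<^sup>2 / c + c3 * \<delta>f + 4 / 3 * \<delta>g"
  define m where "m j = c4 * D\<^sup>2 * (\<integral>\<omega>. min (M j \<omega>) (c2 * Lf + c) \<partial>P)" for j
  note step = expected_step[OF n c \<Phi>]
  have "(\<integral>\<omega>. gap (Suc n) \<omega> \<partial>P) + (\<integral>\<omega>. \<Phi> (Suc n) \<omega> \<partial>P) \<le> (\<integral>\<omega>. \<Phi> n \<omega> \<partial>P) + K + (m (Suc n) - m n)"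
    using step(3) unfolding K_def m_def by (simp add: right_diff_distrib)
  moreover have "(\<Sum>k=1..n. \<integral>\<omega>. gap k \<omega> \<partial>P) + (\<integral>\<omega>. \<Phi> n \<omega> \<partial>P) \<le> real n * K + m n"
    using Suc unfolding K_def m_def by simp
  ultimately have "(\<Sum>k=1..Suc n. \<integral>\<omega>. gap k \<omega> \<partial>P) + (\<integral>\<omega>. \<Phi> (Suc n) \<omega> \<partial>P)
      \<le> real (Suc n) * K + m (Suc n)"
    by (simp add: distrib_right)
  then show ?case
    using step(1,2) Suc unfolding K_def m_def by (auto simp: atLeastAtMostSuc_conv)
qed

text \<open>Any admissible \<open>c\<close> will do; adding 1 makes it positive even when
  \<open>Lg = 0\<close>.\<close>

lemma gap_integrable: "1 \<le> k \<Longrightarrow> k \<le> N \<Longrightarrow> integrable P (gap k)"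
  using expected_telescope[of "12 * c1 * Lg + 1" N] c_pos Lg_nonneg
  by (simp add: add_nonneg_pos)

text \<open>The final potential is nonnegative and is dropped, and the last clipped coefficient is
  at most the clipping level.\<close>

lemma sum_expected_gap:
  assumes c: "0 < c" "12 * c1 * Lg \<le> c"
  shows "(\<Sum>k=1..N. \<integral>\<omega>. gap k \<omega> \<partial>P) / real N
    \<le> c4 * (c2 * Lf + c) * D\<^sup>2 / real N + 6 * c1 * \<sigma>\<^sup>2 / c + (c3 * \<delta>f + 4 / 3 * \<delta>g)"
proof -
  have nonneg: "0 \<le> c2 * Lf + c"
    using c c_pos smooth_nonneg by simp
  have "(\<integral>\<omega>. min (M N \<omega>) (c2 * Lf + c) \<partial>P) \<le> (\<integral>\<omega>. c2 * Lf + c \<partial>P)"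
    by (intro integral_mono clipped_integrable nonneg) auto
  then have "c4 * D\<^sup>2 * (\<integral>\<omega>. min (M N \<omega>) (c2 * Lf + c) \<partial>P) \<le> c4 * D\<^sup>2 * (c2 * Lf + c)"
    using c_pos by (intro mult_left_mono) (auto simp: prob_space)
  moreover have "0 \<le> (\<integral>\<omega>. \<Phi> N \<omega> \<partial>P)"
    by (intro Bochner_Integration.integral_nonneg) (simp add: \<Phi>_nonneg)
  ultimately have "(\<Sum>k=1..N. \<integral>\<omega>. gap k \<omega> \<partial>P)
      \<le> real N * (6 * c1 * \<sigma>\<^sup>2 / c + (c3 * \<delta>f + 4 / 3 * \<delta>g)) + c4 * (c2 * Lf + c) * D\<^sup>2"
    using expected_telescope[OF c order_refl] by (simp add: ac_simps)
  then have "(\<Sum>k=1..N. \<integral>\<omega>. gap k \<omega> \<partial>P) / real N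
      \<le> (real N * (6 * c1 * \<sigma>\<^sup>2 / c + (c3 * \<delta>f + 4 / 3 * \<delta>g)) + c4 * (c2 * Lf + c) * D\<^sup>2) / real N"
    by (intro divide_right_mono) auto
  also have "\<dots> = c4 * (c2 * Lf + c) * D\<^sup>2 / real N + 6 * c1 * \<sigma>\<^sup>2 / c + (c3 * \<delta>f + 4 / 3 * \<delta>g)"
    using N_pos by (simp add: add_divide_distrib)
  finally show ?thesis .
qed

section \<open>The averaged iterate and the final rate\<close>

lemma average_bound:
  assumes \<omega>: "\<omega> \<in> space P"
  shows "average_iterate N x \<omega> \<in> edom \<psi>"
    and "F (average_iterate N x \<omega>) - F xstar \<le> (\<Sum>k=1..N. gap k \<omega>) / real N"
proof -
  have dom: "\<And>k. k \<in> {1..N} \<Longrightarrow> x k \<omega> \<in> edom \<psi>"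
    using \<omega> by (intro x_dom) auto
  have avg: "average_iterate N x \<omega> = (\<Sum>k=1..N. (1 / real N) *\<^sub>R x k \<omega>)"
    by (simp add: average_iterate_def scaleR_sum_right)
  have weights: "(\<Sum>k=1..N. 1 / real N) = 1"
    using N_pos by simp
  show "average_iterate N x \<omega> \<in> edom \<psi>"
    unfolding avg using dom weights by (intro convex_sum convex_edom psi) auto
  have "convex_on (edom \<psi>) F"
    using convex_f psi
    by (intro convex_on_add convex_on_edom convex_on_subset[OF convex_f]) (auto intro: convex_edom)
  from convex_on_sum[OF _ _ this weights _ dom]
  have "F (average_iterate N x \<omega>) \<le> (\<Sum>k=1..N. 1 / real N * F (x k \<omega>))"
    unfolding avg using N_pos by auto
  also have "\<dots> = (\<Sum>k=1..N. gap k \<omega>) / real N + F xstar"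
    using N_pos by (simp add: gap_def sum_subtractf sum_divide_distrib[symmetric] diff_divide_distrib)
  finally show "F (average_iterate N x \<omega>) - F xstar \<le> (\<Sum>k=1..N. gap k \<omega>) / real N"
    by simp
qed

lemma expected_gap_average:
  shows "integrable P (\<lambda>\<omega>. F (average_iterate N x \<omega>))"
    and "(\<integral>\<omega>. F (average_iterate N x \<omega>) \<partial>P) - F xstar
      \<le> (\<Sum>k=1..N. \<integral>\<omega>. gap k \<omega> \<partial>P) / real N"
proof -
  have sum: "integrable P (\<lambda>\<omega>. (\<Sum>k=1..N. gap k \<omega>) / real N)"
    by (intro integrable_divide Bochner_Integration.integrable_sum gap_integrable) auto
  have "average_iterate N x \<in> borel_measurable P"
    unfolding average_iterate_def [abs_def]
    by (intro borel_measurable_scaleR borel_measurable_sum x_measurable) auto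
  then have meas: "(\<lambda>\<omega>. F (average_iterate N x \<omega>) - F xstar) \<in> borel_measurable P"
    by measurable
  \<comment> \<open>The gap of the average lies between 0, by optimality of \<open>xstar\<close>,
    and the mean of the gaps, by Jensen's inequality.\<close>
  have int: "integrable P (\<lambda>\<omega>. F (average_iterate N x \<omega>) - F xstar)"
  proof (rule Bochner_Integration.integrable_bound[OF sum meas], rule AE_I2)
    fix \<omega> assume "\<omega> \<in> space P"
    from average_bound[OF this]
    show "norm (F (average_iterate N x \<omega>) - F xstar) \<le> norm ((\<Sum>k=1..N. gap k \<omega>) / real N)"
      using F_xstar_le[of "average_iterate N x \<omega>"] unfolding real_norm_def by linarith
  qed
  from Bochner_Integration.integrable_add[OF int integrable_const[of "F xstar"]]
  show F: "integrable P (\<lambda>\<omega>. F (average_iterate N x \<omega>))"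
    by simp
  have "(\<integral>\<omega>. F (average_iterate N x \<omega>) - F xstar \<partial>P) \<le> (\<integral>\<omega>. (\<Sum>k=1..N. gap k \<omega>) / real N \<partial>P)"
    by (intro integral_mono int sum average_bound(2))
  also have "\<dots> = (\<Sum>k=1..N. \<integral>\<omega>. gap k \<omega> \<partial>P) / real N"
    by (subst integral_divide_zero, subst Bochner_Integration.integral_sum) (auto intro: gap_integrable)
  also have "(\<integral>\<omega>. F (average_iterate N x \<omega>) - F xstar \<partial>P)
      = (\<integral>\<omega>. F (average_iterate N x \<omega>) \<partial>P) - F xstar"
    using F by (subst Bochner_Integration.integral_diff) (auto simp: prob_space)
  finally show "(\<integral>\<omega>. F (average_iterate N x \<omega>) \<partial>P) - F xstar
      \<le> (\<Sum>k=1..N. \<integral>\<omega>. gap k \<omega> \<partial>P) / real N" .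
qed

text \<open>The parameter \<open>c\<close> occurs in the analysis but not in the method, so the
  bound may be optimized over it, with \<open>12 * c1 * Lg\<close> as the lower limit.\<close>

lemma convergence_bound:
  "(\<integral>\<omega>. F (average_iterate N x \<omega>) \<partial>P) - F xstar
    \<le> c4 * (c2 * Lf + 12 * c1 * Lg) * D\<^sup>2 / real N
      + 2 * \<sigma> * D * sqrt (6 * c1 * c4 / real N) + (c3 * \<delta>f + 4 / 3 * \<delta>g)"
proof (rule expected_gap_bound_optimized)
  show "(\<integral>\<omega>. F (average_iterate N x \<omega>) \<partial>P) - F xstar
      \<le> c4 * (c2 * Lf + c) * D\<^sup>2 / real N + 6 * c1 * \<sigma>\<^sup>2 / c + (c3 * \<delta>f + 4 / 3 * \<delta>g)"
    if "0 < c" "12 * c1 * Lg \<le> c" for c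
    using expected_gap_average(2) sum_expected_gap[OF that] by (rule order_trans)
qed (use D_pos c_pos N_pos \<sigma>_nonneg Lg_nonneg in auto)

end

theorem theorem7:
  fixes B :: "real^'n^'n"
    and f fbar :: "real^'n \<Rightarrow> real" and gbar :: "real^'n \<Rightarrow> real^'n"
    and \<psi> :: "real^'n \<Rightarrow> ereal" and xstar x0 :: "real^'n"
    and \<Xi> :: "'s measure" and g :: "real^'n \<Rightarrow> 's \<Rightarrow> real^'n"
    and upd :: "real \<Rightarrow> real \<Rightarrow> real^'n \<Rightarrow> real^'n \<Rightarrow> real^'n \<Rightarrow> real^'n \<Rightarrow> real"
    and P :: "'w measure" and N :: nat
    and s :: "nat \<Rightarrow> 'w \<Rightarrow> 's" and x :: "nat \<Rightarrow> 'w \<Rightarrow> real^'n" and M :: "nat \<Rightarrow> 'w \<Rightarrow> real"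
    and \<delta>f Lf \<delta>g Lg D \<sigma> c1 c2 c3 c4 :: real
  assumes "positive_definite B"
    and "convex_on UNIV f" and "proper_closed_convex \<psi>"
    and "is_arg_min (objective f \<psi>) (\<lambda>y. y \<in> edom \<psi>) xstar"
    and "approx_smooth B \<delta>f Lf f fbar gbar" and "fbar \<in> borel_measurable borel"
    and "0 < D" and "\<forall>y \<in> edom \<psi>. \<forall>z \<in> edom \<psi>. bnorm B (y - z) \<le> D"
    and "stochastic_oracle \<Xi> g" and "unbiased \<Xi> g gbar"
    and "0 \<le> \<delta>g" and "0 \<le> Lg"
    and "\<forall>y z. oracle_var2 B \<Xi> g gbar y z \<le> ennreal (2 * Lg * (lin_err f fbar gbar y z + \<delta>g))"
    and "0 \<le> \<sigma>" and "oracle_var B \<Xi> g gbar xstar = ennreal (\<sigma>\<^sup>2)"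
    and "0 < c1" and "0 < c2" and "0 < c3" and "0 < c4"
    and "prob_space P"
    and "\<forall>\<Omega> > 0. (\<lambda>(m, y, yp, gy, gyp). upd m \<Omega> y yp gy gyp) \<in> borel_measurable borel"
    and "stepsize_requirement P B f fbar gbar \<psi> \<Xi> g \<delta>f Lf upd c1 c2 c3 c4"
    and "1 \<le> N" and "x0 \<in> edom \<psi>"
    and "universal_sgd P B \<psi> \<Xi> g upd x0 0 N D s x M"
  shows "(\<forall>\<omega> \<in> space P. average_iterate N x \<omega> \<in> edom \<psi>) \<and>
         integrable P (\<lambda>\<omega>. real_of_ereal (objective f \<psi> (average_iterate N x \<omega>))) \<and>
         (\<integral>\<omega>. real_of_ereal (objective f \<psi> (average_iterate N x \<omega>)) \<partial>P)
           - real_of_ereal (optimal_value f \<psi>)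
         \<le> c4 * (c2 * Lf + 12 * c1 * Lg) * D\<^sup>2 / real N
           + 2 * \<sigma> * D * sqrt (6 * c1 * c4 / real N)
           + c3 * \<delta>f + 4 / 3 * \<delta>g"
proof -
  interpret universal_sgd_run B f fbar gbar \<psi> xstar x0 \<Xi> g upd P N s x M \<delta>f Lf \<delta>g Lg D \<sigma> c1 c2 c3 c4
    by (rule universal_sgd_run.intro) (fact assms)+
  have dom: "average_iterate N x \<omega> \<in> edom \<psi>" if "\<omega> \<in> space P" for \<omega>
    using that by (rule average_bound(1))
  \<comment> \<open>The average stays in the domain, where the objective is finite, so the passage
    to real values loses nothing.\<close>
  have obj: "real_of_ereal (objective f \<psi> (average_iterate N x \<omega>)) = F (average_iterate N x \<omega>)"
    if "\<omega> \<in> space P" for \<omega>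
    using real_of_objective[OF psi dom[OF that]] .
  have opt: "real_of_ereal (optimal_value f \<psi>) = F xstar"
    using real_of_objective[OF psi xstar_dom] by (simp add: optimal_value_eq[OF xstar])
  have "integrable P (\<lambda>\<omega>. real_of_ereal (objective f \<psi> (average_iterate N x \<omega>)))"
    using expected_gap_average(1) by (simp add: obj cong: Bochner_Integration.integrable_cong)
  moreover have "(\<integral>\<omega>. real_of_ereal (objective f \<psi> (average_iterate N x \<omega>)) \<partial>P)
      = (\<integral>\<omega>. F (average_iterate N x \<omega>) \<partial>P)"
    by (intro Bochner_Integration.integral_cong obj refl)
  ultimately show ?thesis
    using dom convergence_bound by (simp add: opt)
qed

end
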